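(* Let $(M^{4n},Q,\omega)$, $n>1$, be an almost quaternionic skew-Hermitian manifold and let $(N^{2k},\hat J,\hat\omega,\hat g)$ be an almost pseudo-Hermitian submanifold of $M^{4n}$, with adapted basis $\{J_1,J_2,J_3\}$. Suppose that $\pi_{J_1}(T^{Q,\omega})(X,Y)=0$ for all $X,Y\in\Gamma(TN)$, and moreover that one of the following equivalent conditions holds: (1) $(\tilde\nabla_X\hat J)Y=0$ for all $X,Y\in\Gamma(TN)$; (2) $\big(\gamma_3(X)J_2(Y)-\gamma_2(X)J_3(Y)\big)^\top=0$ for all $X,Y\in\Gamma(TN)$; (3) the connection $\tilde\nabla$ is metric with respect to $\hat g$, i.e. $\tilde\nabla\hat g=0$. Then the almost complex structure $\hat J$ is integrable. (The equivalence of (1), (2), (3) is part of the claim.)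
   Context: An almost quaternionic structure on $M^{4n}$ ($n>1$) is a rank-3 subbundle $Q\subset\mathrm{End}(TM)$ locally spanned by an admissible basis $J_1,J_2,J_3$, i.e. $J_a^2=-\mathrm{Id}$, $J_1J_2=J_3=-J_2J_1$. An almost quaternionic skew-Hermitian (qs-H) manifold $(M^{4n},Q,\omega)$ is such a manifold with a non-degenerate 2-form $\omega$ satisfying $\omega(J_aX,J_aY)=\omega(X,Y)$ for every admissible basis. Adapted connection. $N_J(X,Y)=[JX,JY]-J[JX,Y]-J[X,JY]-[X,Y]$. The Obata connection $\nabla^H$ of an admissible basis $H=\{J_a\}$ is the unique connection with $\nabla^HJ_a=0$ and torsion $T^H=\frac16\sum_aN_{J_a}$. With $\mathrm{vol}=\omega^{2n}$, the unimodular Oproiu connection $\nabla^{Q,\mathrm{vol}}$ is the unique connection preserving $Q$ and $\mathrm{vol}$ whose torsion is, for any admissible basis, $T^Q=T^H+\sum_a\partial(\tau_a\otimes J_a)$, where $\tau_a(X)=\frac1{4n-2}\mathrm{tr}(J_aT^H_X)$ and $\partial(\tau\otimes J)(X,Y)=\tau(X)JY-\tau(Y)JX$. Then $\nabla^{Q,\omega}=\nabla^{Q,\mathrm{vol}}+A$ with $\omega(A(X,Y),Z)=\frac12(\nabla^{Q,\mathrm{vol}}_X\omega)(Y,Z)$; it preserves $Q$ and $\omega$, and $T^{Q,\omega}$ is its torsion. Given an admissible basis, local 1-forms $\gamma_a$ are defined by $\nabla^{Q,\omega}_XJ_a=\gamma_c(X)J_b-\gamma_b(X)J_c$ for every cyclic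 permutation $(a,b,c)$ of $(1,2,3)$. For a $TM$-valued 2-form $\phi$: $\pi_{J_1}(\phi)(X,Y)=\frac14\big(\phi(X,Y)+J_1(\phi(J_1X,Y)+\phi(X,J_1Y))-\phi(J_1X,J_1Y)\big)$. An almost complex submanifold $(N^{2k},\hat J)$ is a submanifold $\iota:N\to M$ with an almost complex structure $\hat J$ that is the restriction to $TN$ of a section of $Q$ along $N$; an adapted basis is a (local) admissible basis with $J_1|_{TN}=\hat J$. An almost pseudo-Hermitian submanifold $(N^{2k},\hat J,\hat\omega,\hat g)$ is an almost complex submanifold with $\hat\omega=\iota^*\omega$ non-degenerate and $\hat g(X,Y)=\hat\omega(X,\hat JY)$. Then $TM|_N=TN\oplus\nu(N)$ with $\nu_x(N)=\{u\in T_xM:\omega(u,v)=0\ \forall v\in T_xN\}$; $\top$ is the projection onto $TN$, and $\tilde\nabla_XY:=(\nabla^{Q,\omega}_XY)^\top$ is the induced connection on $N$. *)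

theory Defs
  imports "HOL-Analysis.Analysis" "HOL-Combinatorics.Permutations"
begin

section \<open>Smooth maps between Euclidean spaces\<close>

text \<open>All partial derivatives up to order \<open>k\<close> exist and are continuous; used on open sets only.\<close>

primrec Ck_on ::
  "nat \<Rightarrow> 'a::euclidean_space set \<Rightarrow> ('a \<Rightarrow> 'b::real_normed_vector) \<Rightarrow> bool" where
  "Ck_on 0 S f \<longleftrightarrow> continuous_on S f"
| "Ck_on (Suc k) S f \<longleftrightarrow>
     (\<forall>x\<in>S. f differentiable (at x)) \<and>
     (\<forall>v. Ck_on k S (\<lambda>x. frechet_derivative f (at x) v))"

definition smooth_on :: "'a::euclidean_space set \<Rightarrow> ('a \<Rightarrow> 'b::real_normed_vector) \<Rightarrow> bool" where
  "smooth_on S f \<longleftrightarrow> (\<forall>k. Ck_on k S f)"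


section \<open>Smooth manifolds\<close>

text \<open>A chart is an open set together with a coordinate map on it.  A smooth manifold is a
  second countable Hausdorff type \<open>'m\<close> with a smooth atlas \<open>A\<close> (not necessarily maximal) of charts
  with values in \<open>'e\<close>; its dimension is \<open>DIM('e)\<close>.\<close>

type_synonym ('m, 'e) chart = "'m set \<times> ('m \<Rightarrow> 'e)"
type_synonym ('m, 'e) atlas = "('m, 'e) chart set"

definition chart_inv :: "('m, 'e) chart \<Rightarrow> 'e \<Rightarrow> 'm" where
  "chart_inv c = inv_into (fst c) (snd c)"

definition smooth_atlas ::
  "('m::{t2_space,second_countable_topology}, 'e::euclidean_space) atlas \<Rightarrow> bool" where
  "smooth_atlas A \<longleftrightarrow>
     (\<Union>c\<in>A. fst c) = UNIV \<and>
     (\<forall>c\<in>A. open (fst c) \<and> open (snd c ` fst c) \<and>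
        homeomorphism (fst c) (snd c ` fst c) (snd c) (chart_inv c)) \<and>
     (\<forall>c\<in>A. \<forall>d\<in>A. smooth_on (snd c ` (fst c \<inter> fst d)) (snd d \<circ> chart_inv c))"

text \<open>Tangent spaces: for every point \<open>p\<close> one chart \<open>chart_at A p\<close> around \<open>p\<close> is chosen, and
  \<open>T\<^sub>pM\<close> is identified with \<open>'e\<close> by means of the coordinates of that chart.  Thus a vector field is
  a function \<open>'m \<Rightarrow> 'e\<close>, but its value at \<open>q\<close> has to be transformed by the Jacobian of a coordinate
  change (\<open>vec_to_chart\<close>) before values at different points can be compared or differentiated.\<close>

definition chart_at :: "('m, 'e) atlas \<Rightarrow> 'm \<Rightarrow> ('m, 'e) chart" where
  "chart_at A p = (SOME c. c \<in> A \<and> p \<in> fst c)"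

text \<open>The components in the chart \<open>c\<close> of the tangent vector \<open>v\<close> at \<open>q\<close>, for \<open>q\<close> in the domain
  of \<open>c\<close>; and, conversely, the tangent vector at \<open>q\<close> with components \<open>w\<close> in the chart \<open>c\<close>.\<close>

definition vec_to_chart ::
  "('m, 'e::euclidean_space) atlas \<Rightarrow> ('m, 'e) chart \<Rightarrow> 'm \<Rightarrow> 'e \<Rightarrow> 'e" where
  "vec_to_chart A c q v =
     frechet_derivative (snd c \<circ> chart_inv (chart_at A q)) (at (snd (chart_at A q) q)) v"

definition vec_from_chart ::
  "('m, 'e::euclidean_space) atlas \<Rightarrow> ('m, 'e) chart \<Rightarrow> 'm \<Rightarrow> 'e \<Rightarrow> 'e" where
  "vec_from_chart A c q w =
     frechet_derivative (snd (chart_at A q) \<circ> chart_inv c) (at (snd c q)) w"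

definition smooth_fun ::
  "('m, 'e::euclidean_space) atlas \<Rightarrow> 'm set \<Rightarrow> ('m \<Rightarrow> 'b::real_normed_vector) \<Rightarrow> bool" where
  "smooth_fun A U f \<longleftrightarrow> (\<forall>c\<in>A. smooth_on (snd c ` (U \<inter> fst c)) (f \<circ> chart_inv c))"

text \<open>The differential \<open>df\<^sub>p(v)\<close>.\<close>

definition dfun ::
  "('m, 'e::euclidean_space) atlas \<Rightarrow> ('m \<Rightarrow> 'b::real_normed_vector) \<Rightarrow> 'm \<Rightarrow> 'e \<Rightarrow> 'b" where
  "dfun A f p v = frechet_derivative (f \<circ> chart_inv (chart_at A p)) (at (snd (chart_at A p) p)) v"

definition field_rep ::
  "('m, 'e::euclidean_space) atlas \<Rightarrow> ('m, 'e) chart \<Rightarrow> ('m \<Rightarrow> 'e) \<Rightarrow> 'e \<Rightarrow> 'e" where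
  "field_rep A c X x = vec_to_chart A c (chart_inv c x) (X (chart_inv c x))"

definition smooth_field ::
  "('m, 'e::euclidean_space) atlas \<Rightarrow> 'm set \<Rightarrow> ('m \<Rightarrow> 'e) \<Rightarrow> bool" where
  "smooth_field A U X \<longleftrightarrow> (\<forall>c\<in>A. smooth_on (snd c ` (U \<inter> fst c)) (field_rep A c X))"

text \<open>Fields that are defined and smooth near \<open>p\<close>.\<close>

definition local_field ::
  "('m::topological_space, 'e::euclidean_space) atlas \<Rightarrow> 'm \<Rightarrow> ('m \<Rightarrow> 'e) \<Rightarrow> bool" where
  "local_field A p X \<longleftrightarrow> (\<exists>U. open U \<and> p \<in> U \<and> smooth_field A U X)"

definition lie_bracket ::
  "('m, 'e::euclidean_space) atlas \<Rightarrow> ('m \<Rightarrow> 'e) \<Rightarrow> ('m \<Rightarrow> 'e) \<Rightarrow> 'm \<Rightarrow> 'e" where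
  "lie_bracket A X Y p =
     (let c = chart_at A p; x = snd c p in
        frechet_derivative (field_rep A c Y) (at x) (field_rep A c X x)
      - frechet_derivative (field_rep A c X) (at x) (field_rep A c Y x))"


section \<open>Tensor fields\<close>

definition smooth_endo ::
  "('m::topological_space, 'e::euclidean_space) atlas \<Rightarrow> 'm set \<Rightarrow> ('m \<Rightarrow> 'e \<Rightarrow> 'e) \<Rightarrow> bool" where
  "smooth_endo A U J \<longleftrightarrow>
     (\<forall>q\<in>U. linear (J q)) \<and>
     (\<forall>V X. open V \<and> V \<subseteq> U \<and> smooth_field A V X \<longrightarrow> smooth_field A V (\<lambda>q. J q (X q)))"

definition smooth_bilin ::
  "('m::topological_space, 'e::euclidean_space) atlas \<Rightarrow> ('m \<Rightarrow> 'e \<Rightarrow> 'e \<Rightarrow> real) \<Rightarrow> bool" where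
  "smooth_bilin A \<omega> \<longleftrightarrow>
     (\<forall>q. bilinear (\<omega> q)) \<and>
     (\<forall>V X Y. open V \<and> smooth_field A V X \<and> smooth_field A V Y
        \<longrightarrow> smooth_fun A V (\<lambda>q. \<omega> q (X q) (Y q)))"

definition nondegenerate :: "('m \<Rightarrow> 'e::euclidean_space \<Rightarrow> 'e \<Rightarrow> real) \<Rightarrow> bool" where
  "nondegenerate \<omega> \<longleftrightarrow> (\<forall>q v. (\<forall>w. \<omega> q v w = 0) \<longrightarrow> v = 0)"

text \<open>An expression \<open>F X Y p\<close> in vector fields that is tensorial in \<open>X\<close> and \<open>Y\<close> defines a bilinear map
  on tangent vectors: \<open>tensor_at A F p v w\<close> is the common value of \<open>F X Y p\<close> for all local fields
  with \<open>X p = v\<close> and \<open>Y p = w\<close>.\<close>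

definition tensor_at ::
  "('m::topological_space, 'e::euclidean_space) atlas
     \<Rightarrow> (('m \<Rightarrow> 'e) \<Rightarrow> ('m \<Rightarrow> 'e) \<Rightarrow> 'm \<Rightarrow> 'e) \<Rightarrow> 'm \<Rightarrow> 'e \<Rightarrow> 'e \<Rightarrow> 'e" where
  "tensor_at A F p v w =
     (THE t. \<forall>X Y. local_field A p X \<and> local_field A p Y \<and> X p = v \<and> Y p = w \<longrightarrow> F X Y p = t)"

definition nijenhuis ::
  "('m, 'e::euclidean_space) atlas \<Rightarrow> ('m \<Rightarrow> 'e \<Rightarrow> 'e)
     \<Rightarrow> ('m \<Rightarrow> 'e) \<Rightarrow> ('m \<Rightarrow> 'e) \<Rightarrow> 'm \<Rightarrow> 'e" where
  "nijenhuis A J X Y p =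
     (let JX = (\<lambda>q. J q (X q)); JY = (\<lambda>q. J q (Y q)) in
        lie_bracket A JX JY p - J p (lie_bracket A JX Y p)
      - J p (lie_bracket A X JY p) - lie_bracket A X Y p)"

definition endo_trace :: "('e::euclidean_space \<Rightarrow> 'e) \<Rightarrow> real" where
  "endo_trace f = (\<Sum>b\<in>Basis. f b \<bullet> b)"

text \<open>The \<open>m\<close>-th exterior power \<open>\<omega> \<and> \<dots> \<and> \<omega>\<close> of a 2-form, evaluated on \<open>v 0, \<dots>, v (2 m - 1)\<close>.\<close>

definition form_power :: "nat \<Rightarrow> ('e \<Rightarrow> 'e \<Rightarrow> real) \<Rightarrow> (nat \<Rightarrow> 'e) \<Rightarrow> real" where
  "form_power m \<omega> v =
     (\<Sum>\<sigma> | \<sigma> permutes {..<2*m}.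
        of_int (sign \<sigma>) * (\<Prod>i<m. \<omega> (v (\<sigma> (2*i))) (v (\<sigma> (2*i+1))))) / 2 ^ m"


section \<open>Affine connections\<close>

text \<open>\<open>D p v Y\<close> is the covariant derivative at \<open>p\<close>, in the direction of the tangent vector \<open>v\<close> at
  \<open>p\<close>, of a vector field \<open>Y\<close> defined and smooth near \<open>p\<close>.\<close>

type_synonym ('m, 'e) conn = "'m \<Rightarrow> 'e \<Rightarrow> ('m \<Rightarrow> 'e) \<Rightarrow> 'e"

definition connection_on ::
  "('m::topological_space, 'e::euclidean_space) atlas \<Rightarrow> 'm set \<Rightarrow> ('m, 'e) conn \<Rightarrow> bool" where
  "connection_on A U D \<longleftrightarrow>
     (\<forall>p\<in>U. \<forall>Y. local_field A p Y \<longrightarrow> linear (\<lambda>v. D p v Y)) \<and>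
     (\<forall>p\<in>U. \<forall>v Y Z. local_field A p Y \<and> local_field A p Z
        \<longrightarrow> D p v (\<lambda>q. Y q + Z q) = D p v Y + D p v Z) \<and>
     (\<forall>p\<in>U. \<forall>v f Y V. open V \<and> p \<in> V \<and> smooth_fun A V f \<and> smooth_field A V Y
        \<longrightarrow> D p v (\<lambda>q. f q *\<^sub>R Y q) = dfun A f p v *\<^sub>R Y p + f p *\<^sub>R D p v Y) \<and>
     (\<forall>p\<in>U. \<forall>v Y Z. local_field A p Y \<and> local_field A p Z \<and> (\<forall>\<^sub>F q in nhds p. Y q = Z q)
        \<longrightarrow> D p v Y = D p v Z) \<and>
     (\<forall>V X Y. open V \<and> V \<subseteq> U \<and> smooth_field A V X \<and> smooth_field A V Y
        \<longrightarrow> smooth_field A V (\<lambda>p. D p (X p) Y))"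

definition torsion ::
  "('m, 'e::euclidean_space) atlas \<Rightarrow> ('m, 'e) conn \<Rightarrow> ('m \<Rightarrow> 'e) \<Rightarrow> ('m \<Rightarrow> 'e) \<Rightarrow> 'm \<Rightarrow> 'e" where
  "torsion A D X Y p = D p (X p) Y - D p (Y p) X - lie_bracket A X Y p"

abbreviation torsion_at ::
  "('m::topological_space, 'e::euclidean_space) atlas \<Rightarrow> ('m, 'e) conn \<Rightarrow> 'm \<Rightarrow> 'e \<Rightarrow> 'e \<Rightarrow> 'e" where
  "torsion_at A D \<equiv> tensor_at A (torsion A D)"

text \<open>\<open>(D\<^sub>v J) Y\<close> for a field of endomorphisms, \<open>(D\<^sub>v \<omega>)(Y, Z)\<close> for a field of bilinear forms, and
  \<open>(D\<^sub>v \<mu>)(W\<^sub>0, \<dots>, W\<^sub>m\<^sub>-\<^sub>1)\<close> for an \<open>m\<close>-form, at the point \<open>p\<close>.\<close>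

definition cov_endo ::
  "('m, 'e::real_vector) conn \<Rightarrow> ('m \<Rightarrow> 'e \<Rightarrow> 'e) \<Rightarrow> 'm \<Rightarrow> 'e \<Rightarrow> ('m \<Rightarrow> 'e) \<Rightarrow> 'e" where
  "cov_endo D J p v Y = D p v (\<lambda>q. J q (Y q)) - J p (D p v Y)"

definition cov_bilin ::
  "('m, 'e::euclidean_space) atlas \<Rightarrow> ('m, 'e) conn \<Rightarrow> ('m \<Rightarrow> 'e \<Rightarrow> 'e \<Rightarrow> real)
     \<Rightarrow> 'm \<Rightarrow> 'e \<Rightarrow> ('m \<Rightarrow> 'e) \<Rightarrow> ('m \<Rightarrow> 'e) \<Rightarrow> real" where
  "cov_bilin A D \<omega> p v Y Z =
     dfun A (\<lambda>q. \<omega> q (Y q) (Z q)) p v - \<omega> p (D p v Y) (Z p) - \<omega> p (Y p) (D p v Z)"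

definition cov_multilin ::
  "('m, 'e::euclidean_space) atlas \<Rightarrow> ('m, 'e) conn \<Rightarrow> nat \<Rightarrow> ('m \<Rightarrow> (nat \<Rightarrow> 'e) \<Rightarrow> real)
     \<Rightarrow> 'm \<Rightarrow> 'e \<Rightarrow> (nat \<Rightarrow> 'm \<Rightarrow> 'e) \<Rightarrow> real" where
  "cov_multilin A D m \<mu> p v W =
     dfun A (\<lambda>q. \<mu> q (\<lambda>i. W i q)) p v
     - (\<Sum>j<m. \<mu> p ((\<lambda>i. W i p)(j := D p v (W j))))"


section \<open>Almost quaternionic skew-Hermitian manifolds\<close>

text \<open>Triples are indexed by the type \<open>3\<close>, whose elements are \<open>1\<close>, \<open>2\<close> and \<open>3 = 0\<close>; since its addition is
  modulo 3, the cyclic permutations of \<open>(1, 2, 3)\<close> are the triples \<open>(a, a + 1, a + 2)\<close>.\<close>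

definition admissible_basis ::
  "('m::topological_space, 'e::euclidean_space) atlas \<Rightarrow> ('m \<Rightarrow> ('e \<Rightarrow> 'e) set)
     \<Rightarrow> 'm set \<Rightarrow> (3 \<Rightarrow> 'm \<Rightarrow> 'e \<Rightarrow> 'e) \<Rightarrow> bool" where
  "admissible_basis A Q U J \<longleftrightarrow>
     open U \<and> (\<forall>a. smooth_endo A U (J a)) \<and>
     (\<forall>q\<in>U. \<forall>v.
        (\<forall>a. J a q (J a q v) = - v) \<and>
        J 1 q (J 2 q v) = J 3 q v \<and> J 2 q (J 1 q v) = - J 3 q v) \<and>
     (\<forall>q\<in>U. Q q = range (\<lambda>x :: 3 \<Rightarrow> real. \<lambda>v. \<Sum>a\<in>UNIV. x a *\<^sub>R J a q v))"

text \<open>The relations defining an admissible basis force its members to be linearly independent, so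
  that \<open>Q\<close> has rank 3.\<close>

definition almost_quaternionic ::
  "('m::topological_space, 'e::euclidean_space) atlas \<Rightarrow> ('m \<Rightarrow> ('e \<Rightarrow> 'e) set) \<Rightarrow> bool" where
  "almost_quaternionic A Q \<longleftrightarrow> (\<forall>p. \<exists>U J. p \<in> U \<and> admissible_basis A Q U J)"

definition almost_qsH ::
  "('m::{t2_space,second_countable_topology}, 'e::euclidean_space) atlas
     \<Rightarrow> ('m \<Rightarrow> ('e \<Rightarrow> 'e) set) \<Rightarrow> ('m \<Rightarrow> 'e \<Rightarrow> 'e \<Rightarrow> real) \<Rightarrow> bool" where
  "almost_qsH A Q \<omega> \<longleftrightarrow>
     smooth_atlas A \<and> almost_quaternionic A Q \<and>
     smooth_bilin A \<omega> \<and> (\<forall>q v w. \<omega> q v w = - \<omega> q w v) \<and> nondegenerate \<omega> \<and>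
     (\<forall>U J. admissible_basis A Q U J
        \<longrightarrow> (\<forall>q\<in>U. \<forall>a v w. \<omega> q (J a q v) (J a q w) = \<omega> q v w))"


section \<open>The adapted connection\<close>

definition obata_connection ::
  "('m::topological_space, 'e::euclidean_space) atlas \<Rightarrow> 'm set \<Rightarrow> (3 \<Rightarrow> 'm \<Rightarrow> 'e \<Rightarrow> 'e)
     \<Rightarrow> ('m, 'e) conn \<Rightarrow> bool" where
  "obata_connection A U J D \<longleftrightarrow>
     connection_on A U D \<and>
     (\<forall>p\<in>U. \<forall>a v Y. local_field A p Y \<longrightarrow> cov_endo D (J a) p v Y = 0) \<and>
     (\<forall>p\<in>U. \<forall>X Y. local_field A p X \<and> local_field A p Y
        \<longrightarrow> torsion A D X Y p = (1/6) *\<^sub>R (\<Sum>a\<in>UNIV. nijenhuis A (J a) X Y p))"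

definition preserves_Q ::
  "('m::topological_space, 'e::euclidean_space) atlas \<Rightarrow> ('m \<Rightarrow> ('e \<Rightarrow> 'e) set)
     \<Rightarrow> ('m, 'e) conn \<Rightarrow> bool" where
  "preserves_Q A Q D \<longleftrightarrow>
     (\<forall>U S. open U \<and> smooth_endo A U S \<and> (\<forall>q\<in>U. S q \<in> Q q) \<longrightarrow>
        (\<forall>p\<in>U. \<forall>v. \<exists>L\<in>Q p. \<forall>Y. local_field A p Y \<longrightarrow> cov_endo D S p v Y = L (Y p)))"

text \<open>\<open>vol = \<omega>\<^sup>2\<^sup>n\<close> is a form of degree \<open>4 n = DIM('e)\<close>.\<close>

definition preserves_vol ::
  "('m::topological_space, 'e::euclidean_space) atlas \<Rightarrow> ('m \<Rightarrow> 'e \<Rightarrow> 'e \<Rightarrow> real)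
     \<Rightarrow> ('m, 'e) conn \<Rightarrow> bool" where
  "preserves_vol A \<omega> D \<longleftrightarrow>
     (\<forall>p v W. (\<forall>i. local_field A p (W i)) \<longrightarrow>
        cov_multilin A D DIM('e) (\<lambda>q. form_power (DIM('e) div 2) (\<omega> q)) p v W = 0)"

text \<open>\<open>oproiu_tau A D J a q v\<close> is \<open>\<tau>\<^sub>a(v)\<close> at \<open>q\<close>, where \<open>D\<close> is the Obata connection of \<open>J\<close> and
  \<open>DIM('e) - 2 = 4 n - 2\<close>.\<close>

definition oproiu_tau ::
  "('m::topological_space, 'e::euclidean_space) atlas \<Rightarrow> ('m, 'e) conn \<Rightarrow> (3 \<Rightarrow> 'm \<Rightarrow> 'e \<Rightarrow> 'e)
     \<Rightarrow> 3 \<Rightarrow> 'm \<Rightarrow> 'e \<Rightarrow> real" where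
  "oproiu_tau A D J a q v =
     endo_trace (\<lambda>w. J a q (torsion_at A D q v w)) / (real DIM('e) - 2)"

definition oproiu_connection ::
  "('m::topological_space, 'e::euclidean_space) atlas \<Rightarrow> ('m \<Rightarrow> ('e \<Rightarrow> 'e) set)
     \<Rightarrow> ('m \<Rightarrow> 'e \<Rightarrow> 'e \<Rightarrow> real) \<Rightarrow> ('m, 'e) conn \<Rightarrow> bool" where
  "oproiu_connection A Q \<omega> D \<longleftrightarrow>
     connection_on A UNIV D \<and> preserves_Q A Q D \<and> preserves_vol A \<omega> D \<and>
     (\<forall>U J DH. admissible_basis A Q U J \<and> obata_connection A U J DH \<longrightarrow>
        (\<forall>q\<in>U. \<forall>v w. torsion_at A D q v w = torsion_at A DH q v w
           + (\<Sum>a\<in>UNIV. oproiu_tau A DH J a q v *\<^sub>R J a q w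
                        - oproiu_tau A DH J a q w *\<^sub>R J a q v)))"

text \<open>\<open>\<nabla> + A\<close> with \<open>\<omega>(A(X,Y),Z) = \<onehalf>(\<nabla>\<^sub>X\<omega>)(Y,Z)\<close>.\<close>

definition adapted_connection ::
  "('m::topological_space, 'e::euclidean_space) atlas \<Rightarrow> ('m \<Rightarrow> 'e \<Rightarrow> 'e \<Rightarrow> real)
     \<Rightarrow> ('m, 'e) conn \<Rightarrow> ('m, 'e) conn" where
  "adapted_connection A \<omega> D p v Y =
     D p v Y + (THE u. \<forall>Z. local_field A p Z \<longrightarrow> \<omega> p u (Z p) = cov_bilin A D \<omega> p v Y Z / 2)"

text \<open>The forms \<open>\<gamma>\<^sub>a\<close> at \<open>p\<close> in the direction \<open>v\<close>, i.e. \<open>\<nabla>\<^sub>vJ\<^sub>a = \<gamma>\<^sub>c(v) J\<^sub>b - \<gamma>\<^sub>b(v) J\<^sub>c\<close> for \<open>(a,b,c)\<close>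
  cyclic.\<close>

definition conn_forms ::
  "('m::topological_space, 'e::euclidean_space) atlas \<Rightarrow> ('m, 'e) conn
     \<Rightarrow> (3 \<Rightarrow> 'm \<Rightarrow> 'e \<Rightarrow> 'e) \<Rightarrow> 'm \<Rightarrow> 'e \<Rightarrow> 3 \<Rightarrow> real" where
  "conn_forms A D J p v =
     (THE \<gamma>. \<forall>a Y. local_field A p Y \<longrightarrow>
        cov_endo D (J a) p v Y = \<gamma> (a + 2) *\<^sub>R J (a + 1) p (Y p) - \<gamma> (a + 1) *\<^sub>R J (a + 2) p (Y p))"

definition pi_J :: "('e \<Rightarrow> 'e) \<Rightarrow> ('e \<Rightarrow> 'e \<Rightarrow> 'e) \<Rightarrow> 'e \<Rightarrow> 'e \<Rightarrow> 'e::real_vector" where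
  "pi_J J \<phi> x y = (1/4) *\<^sub>R (\<phi> x y + J (\<phi> (J x) y + \<phi> x (J y)) - \<phi> (J x) (J y))"


section \<open>Submanifolds\<close>

text \<open>A submanifold is given by an immersion \<open>i\<close>; its differential at \<open>p\<close> is \<open>tmap B A i p\<close>.\<close>

definition tmap ::
  "('p, 'f::euclidean_space) atlas \<Rightarrow> ('m, 'e::euclidean_space) atlas \<Rightarrow> ('p \<Rightarrow> 'm)
     \<Rightarrow> 'p \<Rightarrow> 'f \<Rightarrow> 'e" where
  "tmap B A i p v =
     frechet_derivative (snd (chart_at A (i p)) \<circ> i \<circ> chart_inv (chart_at B p))
       (at (snd (chart_at B p) p)) v"

definition immersion ::
  "('p::topological_space, 'f::euclidean_space) atlas
     \<Rightarrow> ('m::topological_space, 'e::euclidean_space) atlas \<Rightarrow> ('p \<Rightarrow> 'm) \<Rightarrow> bool" where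
  "immersion B A i \<longleftrightarrow>
     continuous_on UNIV i \<and>
     (\<forall>b\<in>B. \<forall>c\<in>A. smooth_on (snd b ` (fst b \<inter> i -` fst c)) (snd c \<circ> i \<circ> chart_inv b)) \<and>
     (\<forall>p. inj (tmap B A i p))"

text \<open>Smooth sections of \<open>TM\<close> along \<open>i\<close>, over an open subset \<open>V\<close> of \<open>N\<close>: functions \<open>Z\<close> with \<open>Z p\<close> a
  tangent vector of \<open>M\<close> at \<open>i p\<close>.\<close>

definition smooth_along ::
  "('p, 'f::euclidean_space) atlas \<Rightarrow> ('m, 'e::euclidean_space) atlas \<Rightarrow> ('p \<Rightarrow> 'm)
     \<Rightarrow> 'p set \<Rightarrow> ('p \<Rightarrow> 'e) \<Rightarrow> bool" where
  "smooth_along B A i V Z \<longleftrightarrow>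
     (\<forall>b\<in>B. \<forall>c\<in>A. smooth_on (snd b ` (V \<inter> fst b \<inter> i -` fst c))
        ((\<lambda>p. vec_to_chart A c (i p) (Z p)) \<circ> chart_inv b))"

definition Q_section_along ::
  "('p::topological_space, 'f::euclidean_space) atlas \<Rightarrow> ('m, 'e::euclidean_space) atlas
     \<Rightarrow> ('p \<Rightarrow> 'm) \<Rightarrow> ('m \<Rightarrow> ('e \<Rightarrow> 'e) set) \<Rightarrow> ('p \<Rightarrow> 'e \<Rightarrow> 'e) \<Rightarrow> bool" where
  "Q_section_along B A i Q S \<longleftrightarrow>
     (\<forall>p. S p \<in> Q (i p)) \<and>
     (\<forall>V Z. open V \<and> smooth_along B A i V Z \<longrightarrow> smooth_along B A i V (\<lambda>p. S p (Z p)))"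

definition almost_complex_structure ::
  "('p::topological_space, 'f::euclidean_space) atlas \<Rightarrow> ('p \<Rightarrow> 'f \<Rightarrow> 'f) \<Rightarrow> bool" where
  "almost_complex_structure B J \<longleftrightarrow> smooth_endo B UNIV J \<and> (\<forall>p v. J p (J p v) = - v)"

text \<open>Integrability of an almost complex structure means here that its Nijenhuis tensor vanishes.\<close>

definition integrable_acs ::
  "('p::topological_space, 'f::euclidean_space) atlas \<Rightarrow> ('p \<Rightarrow> 'f \<Rightarrow> 'f) \<Rightarrow> bool" where
  "integrable_acs B J \<longleftrightarrow>
     (\<forall>p X Y. local_field B p X \<and> local_field B p Y \<longrightarrow> nijenhuis B J X Y p = 0)"

definition almost_complex_submanifold ::
  "('m::{t2_space,second_countable_topology}, 'e::euclidean_space) atlas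
     \<Rightarrow> ('m \<Rightarrow> ('e \<Rightarrow> 'e) set)
     \<Rightarrow> ('p::{t2_space,second_countable_topology}, 'f::euclidean_space) atlas
     \<Rightarrow> ('p \<Rightarrow> 'm) \<Rightarrow> ('p \<Rightarrow> 'f \<Rightarrow> 'f) \<Rightarrow> bool" where
  "almost_complex_submanifold A Q B i Jh \<longleftrightarrow>
     smooth_atlas B \<and> immersion B A i \<and> almost_complex_structure B Jh \<and>
     (\<exists>S. Q_section_along B A i Q S \<and>
          (\<forall>p v. S p (tmap B A i p v) = tmap B A i p (Jh p v)))"

definition adapted_basis ::
  "('m::topological_space, 'e::euclidean_space) atlas \<Rightarrow> ('m \<Rightarrow> ('e \<Rightarrow> 'e) set)
     \<Rightarrow> ('p, 'f::euclidean_space) atlas \<Rightarrow> ('p \<Rightarrow> 'm) \<Rightarrow> ('p \<Rightarrow> 'f \<Rightarrow> 'f)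
     \<Rightarrow> 'm set \<Rightarrow> (3 \<Rightarrow> 'm \<Rightarrow> 'e \<Rightarrow> 'e) \<Rightarrow> bool" where
  "adapted_basis A Q B i Jh U J \<longleftrightarrow>
     admissible_basis A Q U J \<and>
     (\<forall>p v. i p \<in> U \<longrightarrow> J 1 (i p) (tmap B A i p v) = tmap B A i p (Jh p v))"

definition induced_form ::
  "('m, 'e::euclidean_space) atlas \<Rightarrow> ('m \<Rightarrow> 'e \<Rightarrow> 'e \<Rightarrow> real)
     \<Rightarrow> ('p, 'f::euclidean_space) atlas \<Rightarrow> ('p \<Rightarrow> 'm) \<Rightarrow> 'p \<Rightarrow> 'f \<Rightarrow> 'f \<Rightarrow> real" where
  "induced_form A \<omega> B i p v w = \<omega> (i p) (tmap B A i p v) (tmap B A i p w)"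

definition induced_metric ::
  "('m, 'e::euclidean_space) atlas \<Rightarrow> ('m \<Rightarrow> 'e \<Rightarrow> 'e \<Rightarrow> real)
     \<Rightarrow> ('p, 'f::euclidean_space) atlas \<Rightarrow> ('p \<Rightarrow> 'm) \<Rightarrow> ('p \<Rightarrow> 'f \<Rightarrow> 'f)
     \<Rightarrow> 'p \<Rightarrow> 'f \<Rightarrow> 'f \<Rightarrow> real" where
  "induced_metric A \<omega> B i Jh p v w = induced_form A \<omega> B i p v (Jh p w)"

definition almost_pseudo_Hermitian_submanifold ::
  "('m::{t2_space,second_countable_topology}, 'e::euclidean_space) atlas
     \<Rightarrow> ('m \<Rightarrow> ('e \<Rightarrow> 'e) set) \<Rightarrow> ('m \<Rightarrow> 'e \<Rightarrow> 'e \<Rightarrow> real)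
     \<Rightarrow> ('p::{t2_space,second_countable_topology}, 'f::euclidean_space) atlas
     \<Rightarrow> ('p \<Rightarrow> 'm) \<Rightarrow> ('p \<Rightarrow> 'f \<Rightarrow> 'f) \<Rightarrow> bool" where
  "almost_pseudo_Hermitian_submanifold A Q \<omega> B i Jh \<longleftrightarrow>
     almost_complex_submanifold A Q B i Jh \<and> nondegenerate (induced_form A \<omega> B i)"

definition normal_space ::
  "('m, 'e::euclidean_space) atlas \<Rightarrow> ('m \<Rightarrow> 'e \<Rightarrow> 'e \<Rightarrow> real)
     \<Rightarrow> ('p, 'f::euclidean_space) atlas \<Rightarrow> ('p \<Rightarrow> 'm) \<Rightarrow> 'p \<Rightarrow> 'e set" where
  "normal_space A \<omega> B i p = {u. \<forall>w. \<omega> (i p) u (tmap B A i p w) = 0}"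

text \<open>\<open>u\<^sup>\<top>\<close>, as an element of the tangent space of \<open>N\<close> at \<open>p\<close>.\<close>

definition tangential ::
  "('m, 'e::euclidean_space) atlas \<Rightarrow> ('m \<Rightarrow> 'e \<Rightarrow> 'e \<Rightarrow> real)
     \<Rightarrow> ('p, 'f::euclidean_space) atlas \<Rightarrow> ('p \<Rightarrow> 'm) \<Rightarrow> 'p \<Rightarrow> 'e \<Rightarrow> 'f" where
  "tangential A \<omega> B i p u = (THE w. u - tmap B A i p w \<in> normal_space A \<omega> B i p)"

text \<open>Covariant derivative of a section \<open>Z\<close> of \<open>TM\<close> along \<open>i\<close>: writing \<open>Z = \<Sum> z\<^sub>b (e\<^sub>b \<circ> i)\<close> in the
  coordinate frame \<open>e\<^sub>b\<close> of the chart chosen at \<open>i p\<close>, it is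
  \<open>\<Sum> dz\<^sub>b(v) e\<^sub>b + z\<^sub>b(p) \<nabla>\<^bsub>di(v)\<^esub> e\<^sub>b\<close>.  This is \<open>\<nabla>\<^bsub>di(v)\<^esub> Y\<close> for any extension \<open>Y\<close> of \<open>Z\<close> to a
  neighbourhood of \<open>i p\<close> in \<open>M\<close>.  In the chart chosen at \<open>i p\<close>, the value of \<open>e\<^sub>b\<close> at \<open>i p\<close> is
  \<open>b\<close> itself.\<close>

definition cov_along ::
  "('m, 'e::euclidean_space) atlas \<Rightarrow> ('m, 'e) conn
     \<Rightarrow> ('p, 'f::euclidean_space) atlas \<Rightarrow> ('p \<Rightarrow> 'm) \<Rightarrow> 'p \<Rightarrow> 'f \<Rightarrow> ('p \<Rightarrow> 'e) \<Rightarrow> 'e" where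
  "cov_along A D B i p v Z =
     (let c = chart_at A (i p); z = (\<lambda>b q. vec_to_chart A c (i q) (Z q) \<bullet> b) in
        \<Sum>b\<in>Basis. dfun B (z b) p v *\<^sub>R b
                 + z b p *\<^sub>R D (i p) (tmap B A i p v) (\<lambda>q. vec_from_chart A c q b))"

definition induced_connection ::
  "('m, 'e::euclidean_space) atlas \<Rightarrow> ('m \<Rightarrow> 'e \<Rightarrow> 'e \<Rightarrow> real) \<Rightarrow> ('m, 'e) conn
     \<Rightarrow> ('p, 'f::euclidean_space) atlas \<Rightarrow> ('p \<Rightarrow> 'm) \<Rightarrow> ('p, 'f) conn" where
  "induced_connection A \<omega> D B i p v Y =
     tangential A \<omega> B i p (cov_along A D B i p v (\<lambda>q. tmap B A i q (Y q)))"

text \<open>In the following conditions \<open>X, Y, Z\<close> range over all local sections of \<open>TN\<close>.  Those that refer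
  to an adapted basis on \<open>U\<close> are imposed at the points of \<open>N\<close> that \<open>i\<close> maps into \<open>U\<close>.\<close>

definition torsion_condition ::
  "('m::topological_space, 'e::euclidean_space) atlas \<Rightarrow> ('m, 'e) conn
     \<Rightarrow> ('p::topological_space, 'f::euclidean_space) atlas \<Rightarrow> ('p \<Rightarrow> 'm)
     \<Rightarrow> 'm set \<Rightarrow> (3 \<Rightarrow> 'm \<Rightarrow> 'e \<Rightarrow> 'e) \<Rightarrow> bool" where
  "torsion_condition A D B i U J \<longleftrightarrow>
     (\<forall>p X Y. i p \<in> U \<and> local_field B p X \<and> local_field B p Y \<longrightarrow>
        pi_J (J 1 (i p)) (torsion_at A D (i p)) (tmap B A i p (X p)) (tmap B A i p (Y p)) = 0)"

definition complex_parallel ::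
  "('p::topological_space, 'f::euclidean_space) atlas \<Rightarrow> ('p, 'f) conn
     \<Rightarrow> ('p \<Rightarrow> 'f \<Rightarrow> 'f) \<Rightarrow> bool" where
  "complex_parallel B D Jh \<longleftrightarrow>
     (\<forall>p X Y. local_field B p X \<and> local_field B p Y \<longrightarrow> cov_endo D Jh p (X p) Y = 0)"

definition gamma_condition ::
  "('m::topological_space, 'e::euclidean_space) atlas \<Rightarrow> ('m \<Rightarrow> 'e \<Rightarrow> 'e \<Rightarrow> real) \<Rightarrow> ('m, 'e) conn
     \<Rightarrow> ('p::topological_space, 'f::euclidean_space) atlas \<Rightarrow> ('p \<Rightarrow> 'm)
     \<Rightarrow> 'm set \<Rightarrow> (3 \<Rightarrow> 'm \<Rightarrow> 'e \<Rightarrow> 'e) \<Rightarrow> bool" where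
  "gamma_condition A \<omega> D B i U J \<longleftrightarrow>
     (\<forall>p X Y. i p \<in> U \<and> local_field B p X \<and> local_field B p Y \<longrightarrow>
        (let \<gamma> = conn_forms A D J (i p) (tmap B A i p (X p)); y = tmap B A i p (Y p) in
           tangential A \<omega> B i p (\<gamma> 3 *\<^sub>R J 2 (i p) y - \<gamma> 2 *\<^sub>R J 3 (i p) y) = 0))"

definition metric_connection ::
  "('p::topological_space, 'f::euclidean_space) atlas \<Rightarrow> ('p, 'f) conn
     \<Rightarrow> ('p \<Rightarrow> 'f \<Rightarrow> 'f \<Rightarrow> real) \<Rightarrow> bool" where
  "metric_connection B D g \<longleftrightarrow>
     (\<forall>p X Y Z. local_field B p X \<and> local_field B p Y \<and> local_field B p Z
        \<longrightarrow> cov_bilin B D g p (X p) Y Z = 0)"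

end

theory Submission
  imports Defs
begin

text \<open>In the coordinates of the chart chosen at a point, a connection is the coordinate derivative plus a
  Christoffel term that is bilinear at the point, so its torsion is the skew part of the Christoffel symbols and the
  covariant derivatives of \<open>J\<^sub>a\<close> and \<open>\<omega>\<close> are pointwise tensors; the same
  formula computes derivatives along \<open>N\<close>. Since \<open>\<omega>\<close> is
  \<open>J\<^sub>a\<close>-invariant and the connection preserves \<open>Q\<close>, so is
  \<open>\<nabla>\<^bsup>Q,vol\<^esup>\<omega>\<close>; hence the correction term commutes with the
  \<open>J\<^sub>a\<close>, and \<open>\<nabla>\<^bsup>Q,\<omega>\<^esup>\<close> preserves \<open>\<omega>\<close>
  and rotates the \<open>J\<^sub>a\<close> by the forms \<open>\<gamma>\<^sub>a\<close>. The projection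
  \<open>\<top>\<close> intertwines \<open>J\<^sub>1\<close> and the complex structure \<open>J\<close> of
  \<open>N\<close>, so \<open>(\<nabla>J)Y = (\<gamma>\<^sub>3J\<^sub>2Y -
  \<gamma>\<^sub>2J\<^sub>3Y)\<^sup>\<top>\<close> for the induced connection, and \<open>(\<nabla>g)(Y,Z) =
  \<omega>(Y, (\<nabla>J)Z)\<close>. If this vanishes, the Nijenhuis tensor of \<open>J\<close> is \<open>4
  \<pi>\<^sub>J\<close> of the tangential part of the torsion; symmetry of second derivatives of the immersion
  identifies the latter with the torsion of the induced connection.\<close>

section \<open>Calculus of smooth maps\<close>

lemma frechet_derivative_eqI: "(f has_derivative f') (at x) \<Longrightarrow> frechet_derivative f (at x) = f'"
  using frechet_derivative_at by metis

text \<open>\<open>frechet_derivative\<close> at a point of \<open>S\<close> takes a full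
  neighbourhood into account. Since \<open>S\<close> is open, agreement on \<open>S\<close> is
  agreement near each of its points, so the derivatives agree on \<open>S\<close> and the induction
  can be applied to them.\<close>

lemma Ck_on_cong:
  assumes "open S" "\<And>x. x \<in> S \<Longrightarrow> f x = g x"
  shows "Ck_on k S f \<longleftrightarrow> Ck_on k S g"
  using assms
proof (induction k arbitrary: f g)
  case 0
  then show ?case by (auto cong: continuous_on_cong)
next
  case (Suc k)
  have *: "h differentiable (at x) \<Longrightarrow> h' differentiable (at x) \<and>
      frechet_derivative h (at x) = frechet_derivative h' (at x)"
    if "x \<in> S" "\<And>y. y \<in> S \<Longrightarrow> h y = h' y" for x and h h' :: "'a \<Rightarrow> 'b"
  proof -
    assume "h differentiable (at x)"
    then have "(h' has_derivative frechet_derivative h (at x)) (at x)"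
      unfolding frechet_derivative_works
      by (rule has_derivative_transform_within_open[OF _ Suc.prems(1)]) (use that in auto)
    then show ?thesis
      using frechet_derivative_eqI differentiable_def by metis
  qed
  have "Ck_on (Suc k) S h \<Longrightarrow> Ck_on (Suc k) S h'"
    if eq: "\<And>y. y \<in> S \<Longrightarrow> h y = h' y" for h h' :: "'a \<Rightarrow> 'b"
  proof -
    assume C: "Ck_on (Suc k) S h"
    have "Ck_on k S (\<lambda>x. frechet_derivative h' (at x) v)" for v
    proof -
      have "frechet_derivative h (at x) v = frechet_derivative h' (at x) v" if "x \<in> S" for x
        using *[OF that eq] C that by auto
      then show ?thesis
        using Suc.IH[OF Suc.prems(1), of "\<lambda>x. frechet_derivative h (at x) v"] C by simp
    qed
    moreover have "h' differentiable (at x)" if "x \<in> S" for x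
      using *[OF that eq] C that by simp
    ultimately show ?thesis by simp
  qed
  note imp = this
  show ?case
    by (rule iffI; erule imp[rotated]) (simp_all add: Suc.prems(2))
qed

lemma Ck_on_subset: "Ck_on k S f \<Longrightarrow> T \<subseteq> S \<Longrightarrow> Ck_on k T f"
  by (induction k arbitrary: f) (auto intro: continuous_on_subset)

text \<open>\<open>Ck_on\<close> lists continuity only at order 0. The base case is that
  differentiability implies continuity; higher orders reduce to it through the directional
  derivatives.\<close>

lemma Ck_on_Suc: "Ck_on (Suc k) S f \<Longrightarrow> Ck_on k S f"
proof (induction k arbitrary: f)
  case 0
  then show ?case
    by (auto simp: continuous_on_eq_continuous_at intro!: continuous_at_imp_continuous_on
        differentiable_imp_continuous_within)
next
  case (Suc k)
  then show ?case unfolding Ck_on.simps(2)[of "Suc k"] Ck_on.simps(2)[of k S f] by blast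
qed

lemma Ck_on_const [simp]: "Ck_on k S (\<lambda>x. c)"
  by (induction k arbitrary: c) auto

lemma Ck_on_add:
  assumes "open S" "Ck_on k S f" "Ck_on k S g"
  shows "Ck_on k S (\<lambda>x. f x + g x)"
  using assms(2,3)
proof (induction k arbitrary: f g)
  case 0
  then show ?case by (auto intro: continuous_intros)
next
  case (Suc k)
  have "frechet_derivative (\<lambda>x. f x + g x) (at x) v
      = frechet_derivative f (at x) v + frechet_derivative g (at x) v" if "x \<in> S" for x v
    using Suc.prems that by (auto simp: frechet_derivative_works
      intro!: frechet_derivative_eqI[THEN fun_cong, THEN trans] has_derivative_add)
  moreover have "Ck_on k S (\<lambda>x. frechet_derivative f (at x) v + frechet_derivative g (at x) v)" for v
    using Suc by auto
  ultimately have "Ck_on k S (\<lambda>x. frechet_derivative (\<lambda>x. f x + g x) (at x) v)" for v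
    by (subst Ck_on_cong[OF assms(1)]) auto
  then show ?case using Suc.prems by (auto intro: differentiable_add)
qed

lemma Ck_on_sum:
  assumes "open S" "\<And>i. i \<in> I \<Longrightarrow> Ck_on k S (f i)"
  shows "Ck_on k S (\<lambda>x. \<Sum>i\<in>I. f i x)"
  using assms(2) by (induction I rule: infinite_finite_induct) (auto intro: Ck_on_add[OF assms(1)])

lemma Ck_on_scaleR:
  assumes "open S" "Ck_on k S f" "Ck_on k S g"
  shows "Ck_on k S (\<lambda>x. f x *\<^sub>R g x)"
  using assms(2,3)
proof (induction k arbitrary: f g)
  case 0
  then show ?case by (auto intro: continuous_intros)
next
  case (Suc k)
  have "frechet_derivative (\<lambda>x. f x *\<^sub>R g x) (at x) v
      = f x *\<^sub>R frechet_derivative g (at x) v + frechet_derivative f (at x) v *\<^sub>R g x"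
    if "x \<in> S" for x v
    using Suc.prems that by (auto simp: frechet_derivative_works
      intro!: frechet_derivative_eqI[THEN fun_cong, THEN trans] has_derivative_scaleR)
  moreover have "Ck_on k S (\<lambda>x. f x *\<^sub>R frechet_derivative g (at x) v
      + frechet_derivative f (at x) v *\<^sub>R g x)" for v
    using Suc.prems by (intro Ck_on_add[OF assms(1)] Suc.IH) (auto dest: Ck_on_Suc simp del: Ck_on.simps, auto)
  ultimately have "Ck_on k S (\<lambda>x. frechet_derivative (\<lambda>x. f x *\<^sub>R g x) (at x) v)" for v
    by (subst Ck_on_cong[OF assms(1)]) auto
  then show ?case using Suc.prems by (auto intro: differentiable_scaleR)
qed

lemma Ck_on_bounded_linear:
  assumes "open S" "bounded_linear h" "Ck_on k S f"
  shows "Ck_on k S (\<lambda>x. h (f x))"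
  using assms(3)
proof (induction k arbitrary: f)
  case 0
  then show ?case using assms(2) by (auto intro: bounded_linear.continuous_on)
next
  case (Suc k)
  have *: "((\<lambda>x. h (f x)) has_derivative (\<lambda>v. h (frechet_derivative f (at x) v))) (at x)"
    if "x \<in> S" for x
    using Suc.prems that by (auto simp: frechet_derivative_works
      intro: bounded_linear.has_derivative[OF assms(2)])
  have "Ck_on k S (\<lambda>x. frechet_derivative (\<lambda>x. h (f x)) (at x) v)" for v
    using Suc by (subst Ck_on_cong[OF assms(1)]) (auto simp: frechet_derivative_eqI[OF *])
  then show ?case using * by (auto simp: differentiable_def)
qed

text \<open>\<open>Ck_on\<close> controls derivatives in fixed directions only. This expansion
  reduces a direction that varies with the point to finitely many fixed ones.\<close>

lemma frechet_derivative_basis: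
  assumes "f differentiable (at x)"
  shows "frechet_derivative f (at x) w = (\<Sum>b\<in>Basis. (w \<bullet> b) *\<^sub>R frechet_derivative f (at x) b)"
proof -
  have "frechet_derivative f (at x) (\<Sum>b\<in>Basis. (w \<bullet> b) *\<^sub>R b)
      = (\<Sum>b\<in>Basis. (w \<bullet> b) *\<^sub>R frechet_derivative f (at x) b)"
    using linear_frechet_derivative[OF assms] by (simp only: linear_sum linear_scale)
  then show ?thesis by (simp only: euclidean_representation)
qed

text \<open>The chain rule differentiates \<open>g\<close> in the moving direction
  \<open>f'(x) v\<close>. Expanded over \<open>Basis\<close>, it becomes a sum of products of
  components of \<open>f'\<close> with partial derivatives of \<open>g\<close> composed with the
  same \<open>f\<close>; hence the induction generalises over \<open>g\<close> alone.\<close>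

lemma Ck_on_compose:
  assumes "open S" "open T" "Ck_on k T g" "Ck_on k S f" "f ` S \<subseteq> T"
  shows "Ck_on k S (\<lambda>x. g (f x))"
  using assms(3,4,5)
proof (induction k arbitrary: g)
  case 0
  then show ?case by (auto intro: continuous_on_compose2)
next
  case (Suc k)
  let ?g' = "\<lambda>y. frechet_derivative g (at y)" and ?f' = "\<lambda>x. frechet_derivative f (at x)"
  have d: "((\<lambda>x. g (f x)) has_derivative (\<lambda>v. ?g' (f x) (?f' x v))) (at x)" if "x \<in> S" for x
  proof -
    have "g differentiable (at (f x))" "f differentiable (at x)"
      using Suc.prems that unfolding Ck_on.simps by blast+
    then show ?thesis
      unfolding frechet_derivative_works by (rule has_derivative_compose[rotated])
  qed
  have "Ck_on k S (\<lambda>x. \<Sum>b\<in>Basis. (?f' x v \<bullet> b) *\<^sub>R ?g' (f x) b)" for v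
  proof (intro Ck_on_sum Ck_on_scaleR assms Ck_on_bounded_linear[OF _ bounded_linear_inner_left])
    show "Ck_on k S (\<lambda>x. ?f' x v)" using Suc.prems(2) by simp
    show "Ck_on k S (\<lambda>x. ?g' (f x) b)" for b
      using Suc.prems by (intro Suc.IH) (auto dest: Ck_on_Suc simp del: Ck_on.simps, auto)
  qed
  moreover have "frechet_derivative (\<lambda>x. g (f x)) (at x) v
      = (\<Sum>b\<in>Basis. (?f' x v \<bullet> b) *\<^sub>R ?g' (f x) b)" if "x \<in> S" for x v
    unfolding frechet_derivative_eqI[OF d[OF that]]
    by (rule frechet_derivative_basis) (use Suc.prems that in auto)
  ultimately have "Ck_on k S (\<lambda>x. frechet_derivative (\<lambda>x. g (f x)) (at x) v)" for v
    by (subst Ck_on_cong[OF assms(1)]) auto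
  then show ?case using d by (auto simp: differentiable_def)
qed

section \<open>Smooth maps\<close>

lemma smooth_on_cong:
  "open S \<Longrightarrow> (\<And>x. x \<in> S \<Longrightarrow> f x = g x) \<Longrightarrow> smooth_on S f \<longleftrightarrow> smooth_on S g"
  unfolding smooth_on_def by (intro iff_allI Ck_on_cong)

lemma smooth_on_subset: "smooth_on S f \<Longrightarrow> T \<subseteq> S \<Longrightarrow> smooth_on T f"
  unfolding smooth_on_def by (intro allI, rule Ck_on_subset) auto

lemma smooth_on_const [simp]: "smooth_on S (\<lambda>x. c)"
  by (simp add: smooth_on_def)

lemma smooth_on_add:
  "open S \<Longrightarrow> smooth_on S f \<Longrightarrow> smooth_on S g \<Longrightarrow> smooth_on S (\<lambda>x. f x + g x)"
  by (simp add: smooth_on_def Ck_on_add)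

lemma smooth_on_sum:
  "open S \<Longrightarrow> (\<And>i. i \<in> I \<Longrightarrow> smooth_on S (f i)) \<Longrightarrow> smooth_on S (\<lambda>x. \<Sum>i\<in>I. f i x)"
  by (simp add: smooth_on_def Ck_on_sum)

lemma smooth_on_scaleR:
  "open S \<Longrightarrow> smooth_on S f \<Longrightarrow> smooth_on S g \<Longrightarrow> smooth_on S (\<lambda>x. f x *\<^sub>R g x)"
  by (simp add: smooth_on_def Ck_on_scaleR)

lemma smooth_on_inner:
  "open S \<Longrightarrow> smooth_on S f \<Longrightarrow> smooth_on S (\<lambda>x. f x \<bullet> b)"
  unfolding smooth_on_def by (intro allI, rule Ck_on_bounded_linear[OF _ bounded_linear_inner_left]) auto

lemma smooth_on_compose:
  "open S \<Longrightarrow> open T \<Longrightarrow> smooth_on T g \<Longrightarrow> smooth_on S f \<Longrightarrow> f ` S \<subseteq> T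
     \<Longrightarrow> smooth_on S (\<lambda>x. g (f x))"
  unfolding smooth_on_def by (intro allI, rule Ck_on_compose[of _ T]) auto

lemma smooth_on_differentiable: "smooth_on S f \<Longrightarrow> x \<in> S \<Longrightarrow> f differentiable (at x)"
  unfolding smooth_on_def by (drule spec[of _ "Suc 0"]) simp

lemma smooth_on_continuous: "smooth_on S f \<Longrightarrow> continuous_on S f"
  unfolding smooth_on_def by (drule spec[of _ 0]) simp

lemma smooth_on_frechet_derivative:
  "smooth_on S f \<Longrightarrow> smooth_on S (\<lambda>x. frechet_derivative f (at x) v)"
  unfolding smooth_on_def using Ck_on.simps(2) by blast

lemma smooth_on_has_derivative:
  "smooth_on S f \<Longrightarrow> x \<in> S \<Longrightarrow> (f has_derivative frechet_derivative f (at x)) (at x)"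
  using smooth_on_differentiable frechet_derivative_works by blast

lemma smooth_on_frechet_derivative_field:
  assumes "open S" "smooth_on S f" "smooth_on S w"
  shows "smooth_on S (\<lambda>x. frechet_derivative f (at x) (w x))"
proof -
  have "smooth_on S (\<lambda>x. \<Sum>b\<in>Basis. (w x \<bullet> b) *\<^sub>R frechet_derivative f (at x) b)"
    using assms by (intro smooth_on_sum smooth_on_scaleR smooth_on_inner smooth_on_frechet_derivative)
  moreover have "frechet_derivative f (at x) (w x)
      = (\<Sum>b\<in>Basis. (w x \<bullet> b) *\<^sub>R frechet_derivative f (at x) b)" if "x \<in> S" for x
    using assms(2) that by (rule frechet_derivative_basis[OF smooth_on_differentiable])
  ultimately show ?thesis by (subst smooth_on_cong[OF assms(1)])
qed

section \<open>Symmetry of second derivatives\<close>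

text \<open>Twofold use of the mean value theorem on the second difference over a parallelogram, which is
  symmetric in the two directions.\<close>

lemma second_difference_mean_value:
  fixes f :: "'a::euclidean_space \<Rightarrow> real"
  assumes "open S" "smooth_on S f" "s > 0" "cball x (s * (norm v + norm w)) \<subseteq> S"
  shows "\<exists>y \<in> cball x (s * (norm v + norm w)).
    f (x + s *\<^sub>R v + s *\<^sub>R w) - f (x + s *\<^sub>R v) - f (x + s *\<^sub>R w) + f x
      = s * s * frechet_derivative (\<lambda>z. frechet_derivative f (at z) v) (at y) w"
proof -
  let ?B = "cball x (s * (norm v + norm w))"
  have inB: "x + a *\<^sub>R v + b *\<^sub>R w \<in> ?B" if "0 \<le> a" "a \<le> s" "0 \<le> b" "b \<le> s" for a b
  proof -
    have "norm (a *\<^sub>R v + b *\<^sub>R w) \<le> a * norm v + b * norm w"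
      using that norm_triangle_ineq[of "a *\<^sub>R v" "b *\<^sub>R w"] by simp
    also have "\<dots> \<le> s * norm v + s * norm w"
      using that by (intro add_mono mult_right_mono) auto
    finally show ?thesis by (simp add: dist_norm norm_minus_commute algebra_simps)
  qed
  let ?f' = "\<lambda>z. frechet_derivative f (at z)"
  have df: "(f has_derivative ?f' z) (at z)" if "z \<in> S" for z
    using smooth_on_has_derivative assms that by blast
  have lf: "linear (?f' z)" if "z \<in> S" for z
    using df[OF that] has_derivative_linear by blast
  have g': "((\<lambda>a. f (x + a *\<^sub>R v + b *\<^sub>R w)) has_real_derivative ?f' (x + a *\<^sub>R v + b *\<^sub>R w) v) (at a)"
    if "0 \<le> a" "a \<le> s" "0 \<le> b" "b \<le> s" for a b
  proof -
    have z: "x + a *\<^sub>R v + b *\<^sub>R w \<in> S" using inB[OF that] assms(4) by auto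
    have "((\<lambda>a. f (x + a *\<^sub>R v + b *\<^sub>R w)) has_derivative (\<lambda>h. ?f' (x + a *\<^sub>R v + b *\<^sub>R w) (h *\<^sub>R v))) (at a)"
      by (rule has_derivative_compose[where g = f and f = "\<lambda>a. x + a *\<^sub>R v + b *\<^sub>R w", OF _ df[OF z]]) (auto intro!: derivative_eq_intros)
    then show ?thesis
      by (simp add: has_field_derivative_def linear_scale[OF lf[OF z]] mult_commute_abs)
  qed
  \<comment> \<open>First mean value, in direction \<open>v\<close>, of the difference in direction
    \<open>w\<close>. The term \<open>0 *\<^sub>R w\<close> is kept so that both summands are
    instances of \<open>g'\<close>.\<close>
  have "((\<lambda>a. f (x + a *\<^sub>R v + s *\<^sub>R w) - f (x + a *\<^sub>R v + 0 *\<^sub>R w)) has_real_derivative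
      ?f' (x + a *\<^sub>R v + s *\<^sub>R w) v - ?f' (x + a *\<^sub>R v + 0 *\<^sub>R w) v) (at a)"
    if "0 \<le> a" "a \<le> s" for a
    using that assms(3) by (intro DERIV_diff g') auto
  from MVT2[OF assms(3) this] obtain a where a: "0 < a" "a < s" and
    A: "(f (x + s *\<^sub>R v + s *\<^sub>R w) - f (x + s *\<^sub>R v + 0 *\<^sub>R w)) - (f (x + 0 *\<^sub>R v + s *\<^sub>R w) - f (x + 0 *\<^sub>R v + 0 *\<^sub>R w))
      = (s - 0) * (?f' (x + a *\<^sub>R v + s *\<^sub>R w) v - ?f' (x + a *\<^sub>R v + 0 *\<^sub>R w) v)"
    by auto
  let ?h = "\<lambda>z. ?f' z v"
  let ?h' = "\<lambda>z. frechet_derivative ?h (at z)"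
  have dh: "(?h has_derivative ?h' z) (at z)" if "z \<in> S" for z
    using smooth_on_has_derivative smooth_on_frechet_derivative assms that by blast
  have h': "((\<lambda>b. ?h (x + a *\<^sub>R v + b *\<^sub>R w)) has_real_derivative ?h' (x + a *\<^sub>R v + b *\<^sub>R w) w) (at b)"
    if "0 \<le> b" "b \<le> s" for b
  proof -
    have z: "x + a *\<^sub>R v + b *\<^sub>R w \<in> S" using inB[of a b] a that assms(4) by auto
    have "((\<lambda>b. ?h (x + a *\<^sub>R v + b *\<^sub>R w)) has_derivative (\<lambda>t. ?h' (x + a *\<^sub>R v + b *\<^sub>R w) (t *\<^sub>R w))) (at b)"
      by (rule has_derivative_compose[where g = ?h and f = "\<lambda>b. x + a *\<^sub>R v + b *\<^sub>R w", OF _ dh[OF z]]) (auto intro!: derivative_eq_intros)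
    then show ?thesis
      by (simp add: has_field_derivative_def linear_scale[OF has_derivative_linear[OF dh[OF z]]]
          mult_commute_abs)
  qed
  from MVT2[OF assms(3) h'] obtain b where b: "0 < b" "b < s" and
    "?h (x + a *\<^sub>R v + s *\<^sub>R w) - ?h (x + a *\<^sub>R v + 0 *\<^sub>R w) = (s - 0) * ?h' (x + a *\<^sub>R v + b *\<^sub>R w) w"
    by auto
  then show ?thesis using A inB[of a b] a b by (intro bexI[of _ "x + a *\<^sub>R v + b *\<^sub>R w"]) auto
qed

text \<open>Both mixed derivatives, taken at possibly different points \<open>y\<close> and
  \<open>z\<close> near \<open>x\<close>, equal the same second difference divided by
  \<open>s * s\<close>. Continuity of the second derivatives at \<open>x\<close> carries the
  equality over to \<open>x\<close>.\<close>

lemma symmetric_second_derivative_real: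
  fixes f :: "'a::euclidean_space \<Rightarrow> real"
  assumes "open S" "smooth_on S f" "x \<in> S"
  shows "frechet_derivative (\<lambda>z. frechet_derivative f (at z) v) (at x) w
       = frechet_derivative (\<lambda>z. frechet_derivative f (at z) w) (at x) v"
proof -
  let ?H = "\<lambda>v w y. frechet_derivative (\<lambda>z. frechet_derivative f (at z) v) (at y) w"
  have cont: "continuous (at x) (?H v w)" for v w
    using assms smooth_on_continuous[OF smooth_on_frechet_derivative[OF smooth_on_frechet_derivative[OF assms(2)]]]
    by (simp add: continuous_on_eq_continuous_at)
  have "dist (?H v w x) (?H w v x) < e" if "e > 0" for e
  proof -
    have "e / 2 > 0" using that by simp
    then obtain d1 where d1: "d1 > 0" "\<And>y. dist y x < d1 \<Longrightarrow> dist (?H v w y) (?H v w x) < e / 2"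
      using cont[of v w] unfolding continuous_at_eps_delta by blast
    obtain d2 where d2: "d2 > 0" "\<And>y. dist y x < d2 \<Longrightarrow> dist (?H w v y) (?H w v x) < e / 2"
      using cont[of w v] \<open>e / 2 > 0\<close> unfolding continuous_at_eps_delta by blast
    obtain d3 where d3: "d3 > 0" "cball x d3 \<subseteq> S"
      using assms open_contains_cball by blast
    \<comment> \<open>Halving the minimum makes \<open>d\<close> strictly smaller than the two
      continuity radii and the radius of a ball inside \<open>S\<close>.\<close>
    define d where "d = Min {d1, d2, d3} / 2"
    have d: "d > 0" "d < d1" "d < d2" "d < d3" using d1(1) d2(1) d3(1) by (auto simp: d_def min_def)
    \<comment> \<open>The summand 1 keeps the denominator positive when both directions
      vanish.\<close>
    define s where "s = d / (norm v + norm w + 1)"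
    have pos: "norm v + norm w + 1 > 0" by (simp add: add_nonneg_pos)
    then have s: "s > 0" and sd: "s * (norm v + norm w + 1) = d"
      using d by (simp_all add: s_def)
    then have "s * (norm v + norm w) \<le> d"
      by (simp only: distrib_left)
    then have B: "cball x (s * (norm v + norm w)) \<subseteq> S" "cball x (s * (norm w + norm v)) \<subseteq> S"
      using d d3(2) by (auto simp: add.commute subset_iff)
    obtain y where y: "y \<in> cball x (s * (norm v + norm w))"
      "f (x + s *\<^sub>R v + s *\<^sub>R w) - f (x + s *\<^sub>R v) - f (x + s *\<^sub>R w) + f x = s * s * ?H v w y"
      using second_difference_mean_value[OF assms(1,2) s B(1)] by blast
    obtain z where z: "z \<in> cball x (s * (norm w + norm v))"
      "f (x + s *\<^sub>R w + s *\<^sub>R v) - f (x + s *\<^sub>R w) - f (x + s *\<^sub>R v) + f x = s * s * ?H w v z"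
      using second_difference_mean_value[OF assms(1,2) s B(2)] by blast
    have "s * s * ?H v w y = s * s * ?H w v z"
      using y(2) z(2) by (simp add: algebra_simps)
    then have "?H v w y = ?H w v z" using s by simp
    moreover have "dist y x \<le> d" "dist z x \<le> d"
      using y(1) z(1) \<open>s * (norm v + norm w) \<le> d\<close> by (auto simp: dist_commute add.commute)
    then have "dist (?H v w y) (?H v w x) < e / 2" "dist (?H w v z) (?H w v x) < e / 2"
      using d1(2) d2(2) d by auto
    ultimately show ?thesis by (metis dist_triangle_half_r)
  qed
  then show ?thesis by (meson dist_pos_lt less_irrefl)
qed

lemma symmetric_second_derivative:
  fixes f :: "'a::euclidean_space \<Rightarrow> 'b::euclidean_space"
  assumes "open S" "smooth_on S f" "x \<in> S"
  shows "frechet_derivative (\<lambda>z. frechet_derivative f (at z) v) (at x) w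
       = frechet_derivative (\<lambda>z. frechet_derivative f (at z) w) (at x) v"
proof (rule euclidean_eqI)
  fix b :: 'b assume "b \<in> Basis"
  have inner: "frechet_derivative g (at z) u \<bullet> b = frechet_derivative (\<lambda>z. g z \<bullet> b) (at z) u"
    if "smooth_on S g" "z \<in> S" for g :: "'a \<Rightarrow> 'b" and z u
    using smooth_on_has_derivative[OF that]
    by (auto intro!: frechet_derivative_eqI[symmetric, THEN fun_cong] derivative_eq_intros)
  have "frechet_derivative (\<lambda>z. frechet_derivative f (at z) v) (at x) w \<bullet> b
      = frechet_derivative (\<lambda>z. frechet_derivative (\<lambda>z. f z \<bullet> b) (at z) v) (at x) w" for v w
  proof -
    have "frechet_derivative (\<lambda>z. frechet_derivative f (at z) v) (at x) w \<bullet> b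
      = frechet_derivative (\<lambda>z. frechet_derivative f (at z) v \<bullet> b) (at x) w"
      using assms by (intro inner smooth_on_frechet_derivative)
    also have "\<dots> = frechet_derivative (\<lambda>z. frechet_derivative (\<lambda>z. f z \<bullet> b) (at z) v) (at x) w"
      using assms inner[OF assms(2)]
      by (subst frechet_derivative_transform_within_open[where X=S])
        (auto intro!: smooth_on_differentiable smooth_on_inner smooth_on_frechet_derivative)
    finally show ?thesis .
  qed
  then show "frechet_derivative (\<lambda>z. frechet_derivative f (at z) v) (at x) w \<bullet> b
    = frechet_derivative (\<lambda>z. frechet_derivative f (at z) w) (at x) v \<bullet> b"
    using symmetric_second_derivative_real[OF assms(1) smooth_on_inner[OF assms(1,2)] assms(3)]
    by simp
qed

section \<open>Charts and coordinate representations\<close>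

text \<open>\<open>vec_to_chart\<close> and \<open>vec_from_chart\<close> are both Jacobians of
  coordinate changes, to and from the chosen chart; one cocycle rule, \<open>jac_comp\<close>, then
  serves for both.\<close>

definition jac :: "('m, 'e::euclidean_space) chart \<Rightarrow> ('m, 'e) chart \<Rightarrow> 'm \<Rightarrow> 'e \<Rightarrow> 'e" where
  "jac c d q = frechet_derivative (snd d \<circ> chart_inv c) (at (snd c q))"

lemma vec_to_chart_jac: "vec_to_chart A c q = jac (chart_at A q) c q"
  by (simp add: fun_eq_iff vec_to_chart_def jac_def)

lemma vec_from_chart_jac: "vec_from_chart A c q = jac c (chart_at A q) q"
  by (simp add: fun_eq_iff vec_from_chart_def jac_def)

section \<open>Coordinate derivatives and Christoffel terms\<close>

definition coord_deriv ::
  "('m, 'e::euclidean_space) atlas \<Rightarrow> 'm \<Rightarrow> 'e \<Rightarrow> ('m \<Rightarrow> 'e) \<Rightarrow> 'e" where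
  "coord_deriv A p v Y =
     frechet_derivative (field_rep A (chart_at A p) Y) (at (snd (chart_at A p) p)) v"

text \<open>The covariant derivatives of the coordinate frame at \<open>p\<close>, extended linearly
  in \<open>y\<close>. In the chart chosen at \<open>p\<close> the frame vectors at \<open>p\<close>
  are the elements of \<open>Basis\<close>, so \<open>y\<close> is its own list of
  components.\<close>

definition christoffel :: "('m, 'e::euclidean_space) atlas \<Rightarrow> ('m, 'e) conn \<Rightarrow> 'm \<Rightarrow> 'e \<Rightarrow> 'e \<Rightarrow> 'e" where
  "christoffel A D p v y =
     (\<Sum>b\<in>Basis. (y \<bullet> b) *\<^sub>R D p v (\<lambda>q. vec_from_chart A (chart_at A p) q b))"

lemma linear_christoffel: "linear (christoffel A D p v)"
  unfolding christoffel_def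
  by (intro linearI) (simp_all add: inner_add_left scaleR_add_left sum.distrib scaleR_sum_right)

text \<open>This is the form in which connections are used below. A true connection has it by
  \<open>coordinate_connectionI\<close>, and it survives the addition of a term linear in
  \<open>Y p\<close>, which is how \<open>adapted_connection\<close> inherits it.\<close>

definition coordinate_connection ::
  "('m::topological_space, 'e::euclidean_space) atlas \<Rightarrow> ('m, 'e) conn \<Rightarrow> bool" where
  "coordinate_connection A D \<longleftrightarrow>
     (\<forall>p v Y. local_field A p Y \<longrightarrow> D p v Y = coord_deriv A p v Y + christoffel A D p v (Y p))"

locale manifold =
  fixes A :: "('m::{t2_space,second_countable_topology}, 'e::euclidean_space) atlas"
  assumes atlas: "smooth_atlas A"
begin

lemma open_chart: "c \<in> A \<Longrightarrow> open (fst c)"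
  using atlas by (simp add: smooth_atlas_def)

lemma homeomorphism_chart:
  "c \<in> A \<Longrightarrow> homeomorphism (fst c) (snd c ` fst c) (snd c) (chart_inv c)"
  using atlas by (simp add: smooth_atlas_def)

lemma chart_inv_left [simp]: "c \<in> A \<Longrightarrow> q \<in> fst c \<Longrightarrow> chart_inv c (snd c q) = q"
  using homeomorphism_chart by (metis homeomorphism_apply1)

lemma open_chart_image:
  assumes "c \<in> A" "open V"
  shows "open (snd c ` (V \<inter> fst c))"
proof -
  have "openin (top_of_set (fst c)) (V \<inter> fst c)"
    using assms open_chart by (simp add: openin_open_eq open_Int)
  then have "openin (top_of_set (snd c ` fst c)) (snd c ` (V \<inter> fst c))"
    using homeomorphism_imp_open_map homeomorphism_chart assms by blast
  moreover have "open (snd c ` fst c)"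
    using atlas assms by (simp add: smooth_atlas_def)
  ultimately show ?thesis using openin_open_trans by blast
qed

lemma open_chart_image_subset: "c \<in> A \<Longrightarrow> open V \<Longrightarrow> V \<subseteq> fst c \<Longrightarrow> open (snd c ` V)"
  using open_chart_image[of c V] by (simp add: Int_absorb2)

lemma chart_at_in [simp, intro]: "chart_at A p \<in> A" and in_chart_at [simp, intro]: "p \<in> fst (chart_at A p)"
proof -
  have "p \<in> (\<Union>c\<in>A. fst c)"
    using atlas by (simp add: smooth_atlas_def)
  then have "\<exists>c. c \<in> A \<and> p \<in> fst c" by blast
  from someI_ex[OF this] show "chart_at A p \<in> A" "p \<in> fst (chart_at A p)"
    by (auto simp: chart_at_def)
qed

lemma smooth_transition:
  "c \<in> A \<Longrightarrow> d \<in> A \<Longrightarrow> smooth_on (snd c ` (fst c \<inter> fst d)) (snd d \<circ> chart_inv c)"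
  using atlas by (simp add: smooth_atlas_def)

lemma has_derivative_jac:
  assumes "c \<in> A" "d \<in> A" "q \<in> fst c" "q \<in> fst d"
  shows "(snd d \<circ> chart_inv c has_derivative jac c d q) (at (snd c q))"
  unfolding jac_def using smooth_on_has_derivative[OF smooth_transition] assms by blast

lemma linear_jac: "c \<in> A \<Longrightarrow> d \<in> A \<Longrightarrow> q \<in> fst c \<Longrightarrow> q \<in> fst d \<Longrightarrow> linear (jac c d q)"
  using has_derivative_jac has_derivative_linear by blast

text \<open>Near \<open>snd c q\<close> the map factors through the transition map into
  \<open>d\<close>, so this is the chain rule. Taking a coordinate map for \<open>f\<close> yields
  the cocycle rule.\<close>

lemma has_derivative_change_chart:
  fixes f :: "'m \<Rightarrow> 'b::real_normed_vector"
  assumes "c \<in> A" "d \<in> A" "q \<in> fst c" "q \<in> fst d"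
    and "(f \<circ> chart_inv d has_derivative f') (at (snd d q))"
  shows "(f \<circ> chart_inv c has_derivative (\<lambda>v. f' (jac c d q v))) (at (snd c q))"
proof (rule has_derivative_transform_within_open)
  have "((f \<circ> chart_inv d) \<circ> (snd d \<circ> chart_inv c) has_derivative f' \<circ> jac c d q) (at (snd c q))"
    using assms by (intro diff_chain_at has_derivative_jac) auto
  then show "((\<lambda>x. (f \<circ> chart_inv d) (snd d (chart_inv c x))) has_derivative (\<lambda>v. f' (jac c d q v)))
      (at (snd c q))"
    by (simp add: o_def)
  show "open (snd c ` (fst d \<inter> fst c))" using assms open_chart open_chart_image by blast
qed (use assms in auto)

lemma jac_comp:
  assumes "c \<in> A" "d \<in> A" "e \<in> A" "q \<in> fst c" "q \<in> fst d" "q \<in> fst e"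
  shows "jac d e q (jac c d q v) = jac c e q v"
  using has_derivative_change_chart[OF assms(1,2,4,5) has_derivative_jac[OF assms(2,3,5,6)]]
  unfolding jac_def[of c e] by (simp add: frechet_derivative_eqI)

lemma jac_self:
  assumes "c \<in> A" "q \<in> fst c"
  shows "jac c c q v = v"
proof -
  have "(snd c \<circ> chart_inv c has_derivative (\<lambda>x. x)) (at (snd c q))"
    by (rule has_derivative_transform_within_open[of "\<lambda>x. x" _ _ _ "snd c ` fst c"])
      (use assms open_chart_image_subset open_chart in \<open>auto intro: has_derivative_ident\<close>)
  then show ?thesis unfolding jac_def by (simp add: frechet_derivative_eqI)
qed

lemma linear_vec_to_chart: "c \<in> A \<Longrightarrow> q \<in> fst c \<Longrightarrow> linear (vec_to_chart A c q)"
  by (simp add: vec_to_chart_jac linear_jac)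

lemma linear_vec_from_chart: "c \<in> A \<Longrightarrow> q \<in> fst c \<Longrightarrow> linear (vec_from_chart A c q)"
  by (simp add: vec_from_chart_jac linear_jac)

lemma vec_to_from [simp]: "c \<in> A \<Longrightarrow> q \<in> fst c \<Longrightarrow> vec_to_chart A c q (vec_from_chart A c q v) = v"
  by (simp add: vec_to_chart_jac vec_from_chart_jac jac_comp jac_self)

lemma vec_from_to [simp]: "c \<in> A \<Longrightarrow> q \<in> fst c \<Longrightarrow> vec_from_chart A c q (vec_to_chart A c q v) = v"
  by (simp add: vec_to_chart_jac vec_from_chart_jac jac_comp jac_self)

lemma vec_to_chart_at [simp]: "vec_to_chart A (chart_at A p) p v = v"
  by (simp add: vec_to_chart_jac jac_self)

lemma vec_from_chart_at [simp]: "vec_from_chart A (chart_at A p) p v = v"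
  by (simp add: vec_from_chart_jac jac_self)

lemma vec_to_chart_change:
  "c \<in> A \<Longrightarrow> d \<in> A \<Longrightarrow> q \<in> fst c \<Longrightarrow> q \<in> fst d \<Longrightarrow> vec_to_chart A d q v = jac c d q (vec_to_chart A c q v)"
  by (simp add: vec_to_chart_jac jac_comp)

lemma field_rep_chart [simp]:
  "c \<in> A \<Longrightarrow> q \<in> fst c \<Longrightarrow> field_rep A c X (snd c q) = vec_to_chart A c q (X q)"
  by (simp add: field_rep_def)

section \<open>Smoothness tested in a single chart, and local fields\<close>

lemma smooth_fun_from_chart:
  assumes "c \<in> A" "open V" "V \<subseteq> fst c" "smooth_on (snd c ` V) (f \<circ> chart_inv c)"
  shows "smooth_fun A V f"
  unfolding smooth_fun_def
proof
  fix d assume d: "d \<in> A"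
  let ?S = "snd d ` (V \<inter> fst d)"
  have "smooth_on ?S (\<lambda>x. (f \<circ> chart_inv c) ((snd c \<circ> chart_inv d) x))"
  proof (rule smooth_on_compose[where T = "snd c ` V"])
    show "open ?S" "open (snd c ` V)"
      using assms open_chart_image[OF d] open_chart_image_subset by auto
    show "smooth_on ?S (snd c \<circ> chart_inv d)"
      by (rule smooth_on_subset[OF smooth_transition[OF d assms(1)]]) (use assms(3) in auto)
  qed (use assms d assms(4)[unfolded o_def] in auto)
  then show "smooth_on ?S (f \<circ> chart_inv d)"
    by (rule smooth_on_cong[THEN iffD1, rotated 2])
      (use assms d open_chart_image[OF d] in \<open>auto simp: subset_iff\<close>)
qed

text \<open>Passing to another chart multiplies the components by the Jacobian of a transition map
  at the moving base point, and both factors are smooth. Fields can therefore be constructed in one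
  chart although smoothness is required in all.\<close>

lemma smooth_field_from_chart:
  assumes "c \<in> A" "open V" "V \<subseteq> fst c" "smooth_on (snd c ` V) (field_rep A c X)"
  shows "smooth_field A V X"
  unfolding smooth_field_def
proof
  fix d assume d: "d \<in> A"
  let ?S = "snd d ` (V \<inter> fst d)" and ?T = "snd c ` (V \<inter> fst d)"
  have op: "open ?S" "open ?T"
    using assms open_chart[OF d] open_chart_image[OF d] open_chart_image_subset[of c "V \<inter> fst d"]
    by auto
  let ?g = "\<lambda>y. frechet_derivative (snd d \<circ> chart_inv c) (at y) (field_rep A c X y)"
  have "smooth_on ?T ?g"
    using assms(3) op
    by (intro smooth_on_frechet_derivative_field smooth_on_subset[OF smooth_transition[OF assms(1) d]]
        smooth_on_subset[OF assms(4)]) auto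
  then have "smooth_on ?S (\<lambda>x. ?g ((snd c \<circ> chart_inv d) x))"
  proof (rule smooth_on_compose[where T = ?T, rotated 2])
    show "smooth_on ?S (snd c \<circ> chart_inv d)"
      by (rule smooth_on_subset[OF smooth_transition[OF d assms(1)]]) (use assms(3) in auto)
  qed (use op d in auto)
  then show "smooth_on ?S (field_rep A d X)"
  proof (rule smooth_on_cong[THEN iffD1, rotated 2])
    fix x assume "x \<in> ?S"
    then obtain q where q: "q \<in> V" "q \<in> fst d" "x = snd d q" by blast
    then show "?g ((snd c \<circ> chart_inv d) x) = field_rep A d X x"
      using assms d vec_to_chart_change[of c d q] by (auto simp: jac_def)
  qed (use op in auto)
qed

lemma smooth_field_const: "c \<in> A \<Longrightarrow> smooth_field A (fst c) (\<lambda>q. vec_from_chart A c q w)"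
proof (rule smooth_field_from_chart)
  assume c: "c \<in> A"
  have "smooth_on (snd c ` fst c) (\<lambda>x. w)" by simp
  then show "smooth_on (snd c ` fst c) (field_rep A c (\<lambda>q. vec_from_chart A c q w))"
    by (rule smooth_on_cong[THEN iffD1, rotated 2])
      (use c open_chart[OF c] open_chart_image_subset[OF c] in auto)
qed (auto simp: open_chart)

lemma smooth_field_scaleR:
  assumes "open V" "smooth_fun A V f" "smooth_field A V Y"
  shows "smooth_field A V (\<lambda>q. f q *\<^sub>R Y q)"
  unfolding smooth_field_def
proof
  fix c assume c: "c \<in> A"
  have "smooth_on (snd c ` (V \<inter> fst c)) (\<lambda>x. (f \<circ> chart_inv c) x *\<^sub>R field_rep A c Y x)"
    using assms c open_chart_image[OF c]
    by (intro smooth_on_scaleR) (simp_all add: smooth_fun_def smooth_field_def o_def)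
  then show "smooth_on (snd c ` (V \<inter> fst c)) (field_rep A c (\<lambda>q. f q *\<^sub>R Y q))"
    by (rule smooth_on_cong[THEN iffD1, rotated 2])
      (use assms c open_chart_image[OF c] linear_scale[OF linear_vec_to_chart[OF c]] in auto)
qed

lemma smooth_field_add:
  assumes "open V" "smooth_field A V X" "smooth_field A V Y"
  shows "smooth_field A V (\<lambda>q. X q + Y q)"
  unfolding smooth_field_def
proof
  fix c assume c: "c \<in> A"
  have "smooth_on (snd c ` (V \<inter> fst c)) (\<lambda>x. field_rep A c X x + field_rep A c Y x)"
    using assms c open_chart_image[OF c]
    by (intro smooth_on_add) (auto simp: smooth_field_def)
  then show "smooth_on (snd c ` (V \<inter> fst c)) (field_rep A c (\<lambda>q. X q + Y q))"
    by (rule smooth_on_cong[THEN iffD1, rotated 2])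
      (use assms c open_chart_image[OF c] linear_add[OF linear_vec_to_chart[OF c]] in auto)
qed

lemma smooth_field_subset: "smooth_field A V X \<Longrightarrow> W \<subseteq> V \<Longrightarrow> smooth_field A W X"
  unfolding smooth_field_def by (meson smooth_on_subset image_mono Int_mono order_refl)

lemma local_field_const [simp]: "c \<in> A \<Longrightarrow> p \<in> fst c \<Longrightarrow> local_field A p (\<lambda>q. vec_from_chart A c q w)"
  unfolding local_field_def using smooth_field_const open_chart by blast

lemma local_field_exists: "\<exists>Y. local_field A p Y \<and> Y p = v"
  by (rule exI[of _ "\<lambda>q. vec_from_chart A (chart_at A p) q v"]) simp

lemma local_field_add:
  assumes "local_field A p X" "local_field A p Y"
  shows "local_field A p (\<lambda>q. X q + Y q)"
proof -
  obtain U V where "open U" "p \<in> U" "smooth_field A U X" "open V" "p \<in> V" "smooth_field A V Y"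
    using assms unfolding local_field_def by blast
  then have "smooth_field A (U \<inter> V) (\<lambda>q. X q + Y q)" "open (U \<inter> V)" "p \<in> U \<inter> V"
    by (auto intro!: smooth_field_add intro: smooth_field_subset)
  then show ?thesis unfolding local_field_def by blast
qed

lemma local_field_nhd:
  assumes "local_field A p X" "open W" "p \<in> W"
  obtains V where "open V" "p \<in> V" "V \<subseteq> W" "V \<subseteq> fst (chart_at A p)" "smooth_field A V X"
    "smooth_on (snd (chart_at A p) ` V) (field_rep A (chart_at A p) X)" "open (snd (chart_at A p) ` V)"
proof -
  let ?c = "chart_at A p"
  obtain U where U: "open U" "p \<in> U" "smooth_field A U X"
    using assms unfolding local_field_def by blast
  let ?V = "U \<inter> W \<inter> fst ?c"
  have "smooth_field A ?V X" using U by (auto intro: smooth_field_subset)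
  then have "smooth_on (snd ?c ` (?V \<inter> fst ?c)) (field_rep A ?c X)"
    unfolding smooth_field_def using chart_at_in by blast
  moreover have "?V \<inter> fst ?c = ?V" "open ?V"
    using U(1) assms(2) open_chart[of ?c] by auto
  moreover have "open (snd ?c ` ?V)"
    using \<open>open ?V\<close> by (intro open_chart_image_subset) auto
  ultimately show thesis
    using \<open>smooth_field A ?V X\<close> U(2) assms(3) by (intro that[of ?V]) auto
qed

lemma local_field_has_derivative:
  assumes "local_field A p X"
  shows "(field_rep A (chart_at A p) X has_derivative (\<lambda>v. coord_deriv A p v X)) (at (snd (chart_at A p) p))"
proof -
  obtain V where "p \<in> V" "smooth_on (snd (chart_at A p) ` V) (field_rep A (chart_at A p) X)"
    by (rule local_field_nhd[OF assms open_UNIV UNIV_I])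
  then show ?thesis
    unfolding coord_deriv_def by (intro smooth_on_has_derivative) auto
qed

lemma local_field_smooth_endo:
  assumes "smooth_endo A U J" "open U" "p \<in> U" "local_field A p Y"
  shows "local_field A p (\<lambda>q. J q (Y q))"
proof -
  obtain V where "open V" "p \<in> V" "V \<subseteq> U" "smooth_field A V Y"
    by (rule local_field_nhd[OF assms(4,2,3)])
  then show ?thesis using assms(1) unfolding smooth_endo_def local_field_def by blast
qed

lemma has_derivative_locally_eq:
  assumes "(f \<circ> chart_inv c has_derivative f') (at (snd c p))" "c \<in> A" "p \<in> fst c"
    and "open V" "p \<in> V" "\<And>q. q \<in> V \<Longrightarrow> f q = g q"
  shows "(g \<circ> chart_inv c has_derivative f') (at (snd c p))"
  by (rule has_derivative_transform_within_open[OF assms(1) open_chart_image[OF assms(2,4)]])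
    (use assms in auto)

lemma dfun_eqI:
  "(f \<circ> chart_inv (chart_at A p) has_derivative f') (at (snd (chart_at A p) p)) \<Longrightarrow> dfun A f p v = f' v"
  unfolding dfun_def by (simp add: frechet_derivative_eqI)

section \<open>Torsion and connections in coordinates\<close>

lemma lie_bracket_coord: "lie_bracket A X Y p = coord_deriv A p (X p) Y - coord_deriv A p (Y p) X"
  by (simp add: lie_bracket_def coord_deriv_def Let_def)

text \<open>The coordinate derivatives of \<open>X\<close> and \<open>Y\<close> cancel against the
  bracket. What is left involves only the values of the fields at \<open>p\<close>, which makes the
  \<open>THE\<close> in \<open>torsion_at\<close> meaningful.\<close>

lemma torsion_coordinate:
  assumes "coordinate_connection A D" "local_field A p X" "local_field A p Y"
  shows "torsion A D X Y p = christoffel A D p (X p) (Y p) - christoffel A D p (Y p) (X p)"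
  using assms by (simp add: torsion_def coordinate_connection_def lie_bracket_coord)

lemma torsion_at_coordinate:
  assumes "coordinate_connection A D"
  shows "torsion_at A D p v w = christoffel A D p v w - christoffel A D p w v"
  unfolding tensor_at_def
proof (rule the_equality)
  fix t assume *: "\<forall>X Y. local_field A p X \<and> local_field A p Y \<and> X p = v \<and> Y p = w \<longrightarrow> torsion A D X Y p = t"
  obtain X Y where "local_field A p X" "X p = v" "local_field A p Y" "Y p = w"
    using local_field_exists by meson
  then show "t = christoffel A D p v w - christoffel A D p w v"
    using * torsion_coordinate[OF assms] by metis
qed (use torsion_coordinate[OF assms] in auto)

text \<open>Near \<open>p\<close> the field is a combination of the coordinate frame with smooth
  coefficients. Locality replaces it by this combination, additivity splits the sum, and the Leibniz
  rule separates the derivatives of the coefficients from the Christoffel term.\<close>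

lemma coordinate_connectionI:
  assumes con: "connection_on A UNIV D"
  shows "coordinate_connection A D"
  unfolding coordinate_connection_def
proof (intro allI impI)
  fix p v Y assume Y: "local_field A p Y"
  let ?c = "chart_at A p"
  let ?x = "snd ?c p"
  obtain V where V: "open V" "p \<in> V" "V \<subseteq> fst ?c" "smooth_field A V Y"
    "smooth_on (snd ?c ` V) (field_rep A ?c Y)" "open (snd ?c ` V)"
    by (rule local_field_nhd[OF Y open_UNIV UNIV_I])
  define E where "E b = (\<lambda>q. vec_from_chart A ?c q b)" for b
  define y where "y b = (\<lambda>q. vec_to_chart A ?c q (Y q) \<bullet> b)" for b
  have Y_eq: "Y q = (\<Sum>b\<in>Basis. y b q *\<^sub>R E b q)" if "q \<in> V" for q
  proof -
    have lin: "linear (vec_from_chart A ?c q)" using that V linear_vec_from_chart by blast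
    have "Y q = vec_from_chart A ?c q (\<Sum>b\<in>Basis. (vec_to_chart A ?c q (Y q) \<bullet> b) *\<^sub>R b)"
      using that V by (simp add: euclidean_representation subset_iff)
    also have "\<dots> = (\<Sum>b\<in>Basis. y b q *\<^sub>R E b q)"
      by (simp only: linear_sum[OF lin] linear_scale[OF lin] y_def E_def)
    finally show ?thesis .
  qed
  have y: "smooth_fun A V (y b)" for b
  proof (rule smooth_fun_from_chart[OF _ V(1,3)])
    show "smooth_on (snd ?c ` V) (y b \<circ> chart_inv ?c)"
      using smooth_on_inner[OF V(6,5), of b] by (simp add: y_def o_def field_rep_def)
  qed simp
  have E: "smooth_field A V (E b)" for b
    unfolding E_def by (rule smooth_field_subset[OF smooth_field_const V(3)]) simp
  have yE: "local_field A p (\<lambda>q. y b q *\<^sub>R E b q)" for b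
    unfolding local_field_def using V smooth_field_scaleR[OF V(1) y E] by blast
  have add: "D p v (\<lambda>q. Y q + Z q) = D p v Y + D p v Z" if "local_field A p Y" "local_field A p Z" for Y Z
    using con that by (simp add: connection_on_def)
  have leibniz: "D p v (\<lambda>q. y b q *\<^sub>R E b q) = dfun A (y b) p v *\<^sub>R E b p + y b p *\<^sub>R D p v (E b)" for b
    using con V(1,2) y[of b] E[of b] unfolding connection_on_def by blast
  \<comment> \<open>The zero field starts the induction over partial sums; additivity applied to 0 +
    0 shows that its derivative vanishes.\<close>
  have zero: "local_field A p (\<lambda>q. 0)"
  proof -
    have "smooth_field A V (\<lambda>q. 0 *\<^sub>R Y q)"
      by (rule smooth_field_scaleR[OF V(1) smooth_fun_from_chart[OF _ V(1,3)] V(4)]) (simp_all add: o_def)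
    then show ?thesis unfolding local_field_def using V by auto
  qed
  \<comment> \<open>The induction carries along that the partial sums are local fields, since
    additivity is available only for these.\<close>
  have "local_field A p (\<lambda>q. \<Sum>b\<in>F. y b q *\<^sub>R E b q) \<and>
      D p v (\<lambda>q. \<Sum>b\<in>F. y b q *\<^sub>R E b q) = (\<Sum>b\<in>F. D p v (\<lambda>q. y b q *\<^sub>R E b q))" if "finite F" for F
    using that
  proof induction
    case empty
    then show ?case using zero add[OF zero zero] by simp
  next
    case (insert b F)
    then show ?case using add[OF yE, of "\<lambda>q. \<Sum>b\<in>F. y b q *\<^sub>R E b q" b] local_field_add[OF yE] by simp
  qed
  from this[OF finite_Basis]
  have sum: "local_field A p (\<lambda>q. \<Sum>b\<in>Basis. y b q *\<^sub>R E b q)"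
    "D p v (\<lambda>q. \<Sum>b\<in>Basis. y b q *\<^sub>R E b q) = (\<Sum>b\<in>Basis. D p v (\<lambda>q. y b q *\<^sub>R E b q))"
    by auto
  have "\<forall>\<^sub>F q in nhds p. Y q = (\<Sum>b\<in>Basis. y b q *\<^sub>R E b q)"
    using Y_eq V(1,2) eventually_nhds by blast
  then have "D p v Y = D p v (\<lambda>q. \<Sum>b\<in>Basis. y b q *\<^sub>R E b q)"
    using con Y sum(1) unfolding connection_on_def by blast
  also have "\<dots> = (\<Sum>b\<in>Basis. dfun A (y b) p v *\<^sub>R E b p + y b p *\<^sub>R D p v (E b))"
    unfolding sum(2) leibniz ..
  also have "\<dots> = (\<Sum>b\<in>Basis. (coord_deriv A p v Y \<bullet> b) *\<^sub>R b) + christoffel A D p v (Y p)"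
  proof -
    have "dfun A (y b) p v = coord_deriv A p v Y \<bullet> b" for b
    proof (rule dfun_eqI)
      show "(y b \<circ> chart_inv ?c has_derivative (\<lambda>v. coord_deriv A p v Y \<bullet> b)) (at ?x)"
        using has_derivative_inner_left[OF local_field_has_derivative[OF Y], of b]
        by (simp add: y_def o_def field_rep_def)
    qed
    then show ?thesis by (simp add: sum.distrib christoffel_def E_def y_def)
  qed
  finally show "D p v Y = coord_deriv A p v Y + christoffel A D p v (Y p)"
    by (simp add: euclidean_representation)
qed

end

section \<open>Covariant derivatives of tensor fields\<close>

lemma linear_basis_sum:
  assumes "linear f"
  shows "(\<Sum>b\<in>Basis. (w \<bullet> b) *\<^sub>R f b) = f w"
proof -
  have "(\<Sum>b\<in>Basis. (w \<bullet> b) *\<^sub>R f b) = f (\<Sum>b\<in>Basis. (w \<bullet> b) *\<^sub>R b)"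
    using assms by (simp only: linear_sum linear_scale)
  then show ?thesis by (simp only: euclidean_representation)
qed

lemma bilinear_basis_sum:
  fixes \<beta> :: "'a::euclidean_space \<Rightarrow> 'a \<Rightarrow> real"
  assumes "bilinear \<beta>"
  shows "(\<Sum>b\<in>Basis. \<Sum>b'\<in>Basis. (u \<bullet> b) * ((w \<bullet> b') * \<beta> b b')) = \<beta> u w"
proof -
  have l: "linear (\<beta> u)" "linear (\<lambda>u. \<beta> u w)" for u w
    using assms by (auto simp: bilinear_def)
  have "(\<Sum>b\<in>Basis. \<Sum>b'\<in>Basis. (u \<bullet> b) * ((w \<bullet> b') * \<beta> b b')) = (\<Sum>b\<in>Basis. (u \<bullet> b) * \<beta> b w)"
    using linear_basis_sum[OF l(1), where w = w] by (simp flip: sum_distrib_left)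
  then show ?thesis using linear_basis_sum[OF l(2)] by simp
qed

text \<open>The derivative of the matrix of \<open>J\<close> in the chart chosen at
  \<open>p\<close>, acting on \<open>w\<close>. By itself it depends on the chart.\<close>

definition endo_deriv ::
  "('m, 'e::euclidean_space) atlas \<Rightarrow> ('m \<Rightarrow> 'e \<Rightarrow> 'e) \<Rightarrow> 'm \<Rightarrow> 'e \<Rightarrow> 'e \<Rightarrow> 'e" where
  "endo_deriv A J p v w =
     (\<Sum>b\<in>Basis. (w \<bullet> b) *\<^sub>R coord_deriv A p v (\<lambda>q. J q (vec_from_chart A (chart_at A p) q b)))"

text \<open>\<open>(\<nabla>\<^sub>v J) w\<close> as a function of vectors at \<open>p\<close>: the
  derivative of the matrix plus its commutator with the Christoffel term.\<close>

definition endo_tensor ::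
  "('m, 'e::euclidean_space) atlas \<Rightarrow> ('m, 'e) conn \<Rightarrow> ('m \<Rightarrow> 'e \<Rightarrow> 'e) \<Rightarrow> 'm \<Rightarrow> 'e \<Rightarrow> 'e \<Rightarrow> 'e" where
  "endo_tensor A D J p v w =
     endo_deriv A J p v w + christoffel A D p v (J p w) - J p (christoffel A D p v w)"

definition bilin_deriv ::
  "('m, 'e::euclidean_space) atlas \<Rightarrow> ('m \<Rightarrow> 'e \<Rightarrow> 'e \<Rightarrow> real) \<Rightarrow> 'm \<Rightarrow> 'e \<Rightarrow> 'e \<Rightarrow> 'e \<Rightarrow> real" where
  "bilin_deriv A \<omega> p v u w =
     (\<Sum>b\<in>Basis. \<Sum>b'\<in>Basis. (u \<bullet> b) * ((w \<bullet> b') *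
        dfun A (\<lambda>q. \<omega> q (vec_from_chart A (chart_at A p) q b) (vec_from_chart A (chart_at A p) q b')) p v))"

text \<open>\<open>(\<nabla>\<^sub>v \<omega>)(u, w)\<close> as a function of vectors at
  \<open>p\<close>.\<close>

definition bilin_tensor ::
  "('m, 'e::euclidean_space) atlas \<Rightarrow> ('m, 'e) conn \<Rightarrow> ('m \<Rightarrow> 'e \<Rightarrow> 'e \<Rightarrow> real)
     \<Rightarrow> 'm \<Rightarrow> 'e \<Rightarrow> 'e \<Rightarrow> 'e \<Rightarrow> real" where
  "bilin_tensor A D \<omega> p v u w =
     bilin_deriv A \<omega> p v u w - \<omega> p (christoffel A D p v u) w - \<omega> p u (christoffel A D p v w)"

lemma linear_bilin_deriv: "linear (bilin_deriv A \<omega> p v u)" "linear (\<lambda>u. bilin_deriv A \<omega> p v u w)"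
  unfolding bilin_deriv_def
  by (intro linearI; simp add: inner_add_left distrib_right distrib_left sum.distrib
      sum_distrib_left mult.assoc mult.left_commute)+

lemma linear_bilin_tensor:
  assumes "bilinear (\<omega> p)"
  shows "linear (bilin_tensor A D \<omega> p v u)" "linear (\<lambda>u. bilin_tensor A D \<omega> p v u w)"
proof -
  have l: "linear (\<omega> p u)" "linear (\<lambda>u. \<omega> p u w)" for u w
    using assms by (auto simp: bilinear_def)
  show "linear (bilin_tensor A D \<omega> p v u)"
    unfolding bilin_tensor_def
    by (intro linear_compose_sub linear_bilin_deriv l
        linear_compose[OF linear_christoffel l(1), unfolded o_def])
  show "linear (\<lambda>u. bilin_tensor A D \<omega> p v u w)"
    unfolding bilin_tensor_def
    by (intro linear_compose_sub linear_bilin_deriv l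
        linear_compose[OF linear_christoffel l(2), unfolded o_def])
qed

context manifold begin

section \<open>Product rules along a map into the manifold\<close>

lemma eventually_in_chart:
  assumes "(g has_derivative g') (at y)" "g y = snd (chart_at A p) p" "open U" "p \<in> U"
  shows "\<forall>\<^sub>F y in nhds y. g y \<in> snd (chart_at A p) ` (U \<inter> fst (chart_at A p))"
proof -
  let ?S = "snd (chart_at A p) ` (U \<inter> fst (chart_at A p))"
  have "isCont g y" using assms(1) has_derivative_continuous by blast
  then have "(g \<longlongrightarrow> g y) (nhds y)"
    by (simp add: continuous_at tendsto_at_iff_tendsto_nhds)
  moreover have "open ?S" using assms(3) by (simp add: open_chart_image)
  moreover have "g y \<in> ?S" using assms by simp
  ultimately show ?thesis by (rule topological_tendstoD)
qed

lemma has_derivative_endo_along: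
  assumes J: "smooth_endo A U J" and U: "open U" "p \<in> U"
    and g: "(g has_derivative g') (at y)" "g y = snd (chart_at A p) p"
    and z: "(z has_derivative z') (at y)"
    and f: "\<forall>\<^sub>F x in nhds y. f x = (let c = chart_at A p; q = chart_inv c (g x) in
      vec_to_chart A c q (J q (vec_from_chart A c q (z x))))"
  shows "(f has_derivative (\<lambda>h. endo_deriv A J p (g' h) (z y) + J p (z' h))) (at y)"
proof -
  let ?c = "chart_at A p"
  let ?E = "\<lambda>b q. vec_from_chart A ?c q b"
  let ?R = "\<lambda>b. field_rep A ?c (\<lambda>q. J q (?E b q))"
  have lJ: "linear (J q)" if "q \<in> U" for q using J that by (simp add: smooth_endo_def)
  have "(?R b has_derivative (\<lambda>v. coord_deriv A p v (\<lambda>q. J q (?E b q)))) (at (g y))" for b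
    unfolding g(2) by (intro local_field_has_derivative local_field_smooth_endo[OF J U]) simp
  then have R: "((\<lambda>y. ?R b (g y)) has_derivative (\<lambda>h. coord_deriv A p (g' h) (\<lambda>q. J q (?E b q)))) (at y)" for b
    by (rule has_derivative_compose[OF g(1)])
  have Ry: "?R b (g y) = J p b" for b unfolding g(2) by simp
  have "((\<lambda>y. \<Sum>b\<in>Basis. (z y \<bullet> b) *\<^sub>R ?R b (g y)) has_derivative
      (\<lambda>h. \<Sum>b\<in>Basis. (z y \<bullet> b) *\<^sub>R coord_deriv A p (g' h) (\<lambda>q. J q (?E b q)) + (z' h \<bullet> b) *\<^sub>R ?R b (g y))) (at y)"
    by (intro has_derivative_sum has_derivative_scaleR R has_derivative_inner_left[OF z])
  also have "(\<lambda>h. \<Sum>b\<in>Basis. (z y \<bullet> b) *\<^sub>R coord_deriv A p (g' h) (\<lambda>q. J q (?E b q)) + (z' h \<bullet> b) *\<^sub>R ?R b (g y))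
      = (\<lambda>h. endo_deriv A J p (g' h) (z y) + J p (z' h))"
    unfolding Ry sum.distrib linear_basis_sum[OF lJ[OF U(2)]] endo_deriv_def ..
  finally have d: "((\<lambda>y. \<Sum>b\<in>Basis. (z y \<bullet> b) *\<^sub>R ?R b (g y)) has_derivative
      (\<lambda>h. endo_deriv A J p (g' h) (z y) + J p (z' h))) (at y)" .
  have ev: "\<forall>\<^sub>F x in nhds y. (\<Sum>b\<in>Basis. (z x \<bullet> b) *\<^sub>R ?R b (g x)) = f x"
    using f eventually_in_chart[OF g U]
  proof eventually_elim
    case (elim x)
    then obtain q where q: "q \<in> U" "q \<in> fst ?c" "g x = snd ?c q" by blast
    have "linear (\<lambda>w. vec_to_chart A ?c q (J q (vec_from_chart A ?c q w)))"
      using linear_compose[OF linear_compose[OF linear_vec_from_chart lJ] linear_vec_to_chart] q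
      by (simp add: o_def)
    from linear_basis_sum[OF this] show ?case using elim(1) q by (simp add: Let_def)
  qed
  show ?thesis
    by (rule has_derivative_transform_eventually[OF d])
      (use ev eventually_nhds_x_imp_x[OF ev] in \<open>auto simp: eventually_at_filter elim: eventually_mono\<close>)
qed

lemma has_derivative_bilin_along:
  assumes \<omega>: "smooth_bilin A \<omega>"
    and g: "(g has_derivative g') (at y)" "g y = snd (chart_at A p) p"
    and z: "(z has_derivative z') (at y)" and w: "(w has_derivative w') (at y)"
    and f: "\<forall>\<^sub>F x in nhds y. f x = (let c = chart_at A p; q = chart_inv c (g x) in
      \<omega> q (vec_from_chart A c q (z x)) (vec_from_chart A c q (w x)))"
  shows "(f has_derivative
    (\<lambda>h. bilin_deriv A \<omega> p (g' h) (z y) (w y) + \<omega> p (z' h) (w y) + \<omega> p (z y) (w' h))) (at y)"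
proof -
  let ?c = "chart_at A p"
  let ?E = "\<lambda>b q. vec_from_chart A ?c q b"
  let ?F = "\<lambda>b b' q. \<omega> q (?E b q) (?E b' q)"
  have bil: "bilinear (\<omega> q)" for q using \<omega> by (simp add: smooth_bilin_def)
  have "smooth_fun A (fst ?c) (?F b b')" for b b'
    using \<omega> smooth_field_const[OF chart_at_in] open_chart[OF chart_at_in]
    unfolding smooth_bilin_def by blast
  then have "smooth_on (snd ?c ` fst ?c) (?F b b' \<circ> chart_inv ?c)" for b b'
    unfolding smooth_fun_def using chart_at_in[of p] by fastforce
  then have "(?F b b' \<circ> chart_inv ?c has_derivative (\<lambda>v. dfun A (?F b b') p v)) (at (g y))" for b b'
    unfolding dfun_def g(2) by (intro smooth_on_has_derivative) auto
  then have R: "((\<lambda>y. (?F b b' \<circ> chart_inv ?c) (g y)) has_derivative (\<lambda>h. dfun A (?F b b') p (g' h))) (at y)" for b b'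
    by (rule has_derivative_compose[OF g(1)])
  have Ry: "(?F b b' \<circ> chart_inv ?c) (g y) = \<omega> p b b'" for b b' unfolding g(2) by simp
  have "((\<lambda>y. \<Sum>b\<in>Basis. \<Sum>b'\<in>Basis. (z y \<bullet> b) * ((w y \<bullet> b') * (?F b b' \<circ> chart_inv ?c) (g y))) has_derivative
      (\<lambda>h. \<Sum>b\<in>Basis. \<Sum>b'\<in>Basis.
         (z y \<bullet> b) * ((w y \<bullet> b') * dfun A (?F b b') p (g' h) + (w' h \<bullet> b') * (?F b b' \<circ> chart_inv ?c) (g y))
         + (z' h \<bullet> b) * ((w y \<bullet> b') * (?F b b' \<circ> chart_inv ?c) (g y)))) (at y)"
    by (intro has_derivative_sum has_derivative_mult R has_derivative_inner_left[OF z]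
        has_derivative_inner_left[OF w])
  also have "(\<lambda>h. \<Sum>b\<in>Basis. \<Sum>b'\<in>Basis.
         (z y \<bullet> b) * ((w y \<bullet> b') * dfun A (?F b b') p (g' h) + (w' h \<bullet> b') * (?F b b' \<circ> chart_inv ?c) (g y))
         + (z' h \<bullet> b) * ((w y \<bullet> b') * (?F b b' \<circ> chart_inv ?c) (g y)))
    = (\<lambda>h. bilin_deriv A \<omega> p (g' h) (z y) (w y) + \<omega> p (z' h) (w y) + \<omega> p (z y) (w' h))"
    unfolding Ry distrib_left sum.distrib bilinear_basis_sum[OF bil] bilin_deriv_def
    by (simp add: algebra_simps)
  finally have d: "((\<lambda>y. \<Sum>b\<in>Basis. \<Sum>b'\<in>Basis. (z y \<bullet> b) * ((w y \<bullet> b') * (?F b b' \<circ> chart_inv ?c) (g y))) has_derivative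
    (\<lambda>h. bilin_deriv A \<omega> p (g' h) (z y) (w y) + \<omega> p (z' h) (w y) + \<omega> p (z y) (w' h))) (at y)" .
  have ev: "\<forall>\<^sub>F x in nhds y.
    (\<Sum>b\<in>Basis. \<Sum>b'\<in>Basis. (z x \<bullet> b) * ((w x \<bullet> b') * (?F b b' \<circ> chart_inv ?c) (g x))) = f x"
    using f eventually_in_chart[OF g open_UNIV UNIV_I]
  proof eventually_elim
    case (elim x)
    then obtain q where q: "q \<in> fst ?c" "g x = snd ?c q" by blast
    then have lin: "linear (vec_from_chart A ?c q)" by (simp add: linear_vec_from_chart)
    have "bilinear (\<lambda>u v. \<omega> q (vec_from_chart A ?c q u) (vec_from_chart A ?c q v))"
      using bil[of q] linear_compose[OF lin] unfolding bilinear_def o_def by blast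
    from bilinear_basis_sum[OF this] show ?case using elim(1) q by (simp add: Let_def)
  qed
  show ?thesis
    by (rule has_derivative_transform_eventually[OF d])
      (use ev eventually_nhds_x_imp_x[OF ev] in \<open>auto simp: eventually_at_filter elim: eventually_mono\<close>)
qed

lemma eventually_chart_image: "\<forall>\<^sub>F x in nhds (snd (chart_at A p) p). x \<in> snd (chart_at A p) ` fst (chart_at A p)"
  using open_chart_image_subset[of "chart_at A p"] open_chart[of "chart_at A p"]
  by (intro eventually_nhds_in_open) auto

lemma coord_deriv_endo:
  assumes "smooth_endo A U J" "open U" "p \<in> U" "local_field A p Y"
  shows "coord_deriv A p v (\<lambda>q. J q (Y q)) = endo_deriv A J p v (Y p) + J p (coord_deriv A p v Y)"
proof -
  let ?c = "chart_at A p"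
  have "(field_rep A ?c (\<lambda>q. J q (Y q)) has_derivative
      (\<lambda>h. endo_deriv A J p h (field_rep A ?c Y (snd ?c p)) + J p (coord_deriv A p h Y))) (at (snd ?c p))"
    by (rule has_derivative_endo_along[OF assms(1-3) has_derivative_ident _ local_field_has_derivative[OF assms(4)]])
      (use eventually_chart_image[of p] in \<open>auto simp: Let_def elim!: eventually_mono\<close>)
  then show ?thesis unfolding coord_deriv_def[of A p v "\<lambda>q. J q (Y q)"] by (simp add: frechet_derivative_eqI)
qed

lemma cov_endo_coordinate:
  assumes "coordinate_connection A D" "smooth_endo A U J" "open U" "p \<in> U" "local_field A p Y"
  shows "cov_endo D J p v Y = endo_tensor A D J p v (Y p)"
proof -
  have "linear (J p)" using assms by (simp add: smooth_endo_def)
  then show ?thesis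
    using assms local_field_smooth_endo[OF assms(2-5)] coord_deriv_endo[OF assms(2-5)]
    by (simp add: cov_endo_def endo_tensor_def coordinate_connection_def linear_add)
qed

lemma has_derivative_bilin_field:
  assumes "smooth_bilin A \<omega>" "local_field A p Y" "local_field A p Z"
  shows "((\<lambda>q. \<omega> q (Y q) (Z q)) \<circ> chart_inv (chart_at A p) has_derivative
    (\<lambda>v. bilin_deriv A \<omega> p v (Y p) (Z p) + \<omega> p (coord_deriv A p v Y) (Z p) + \<omega> p (Y p) (coord_deriv A p v Z)))
    (at (snd (chart_at A p) p))"
proof -
  let ?c = "chart_at A p"
  have "((\<lambda>q. \<omega> q (Y q) (Z q)) \<circ> chart_inv ?c has_derivative
      (\<lambda>v. bilin_deriv A \<omega> p v (field_rep A ?c Y (snd ?c p)) (field_rep A ?c Z (snd ?c p))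
        + \<omega> p (coord_deriv A p v Y) (field_rep A ?c Z (snd ?c p))
        + \<omega> p (field_rep A ?c Y (snd ?c p)) (coord_deriv A p v Z))) (at (snd ?c p))"
    by (rule has_derivative_bilin_along[OF assms(1) has_derivative_ident _
          local_field_has_derivative[OF assms(2)] local_field_has_derivative[OF assms(3)]])
      (use eventually_chart_image[of p] in \<open>auto simp: Let_def elim!: eventually_mono\<close>)
  then show ?thesis by simp
qed

lemma cov_bilin_coordinate:
  assumes "coordinate_connection A D" "smooth_bilin A \<omega>" "local_field A p Y" "local_field A p Z"
  shows "cov_bilin A D \<omega> p v Y Z = bilin_tensor A D \<omega> p v (Y p) (Z p)"
proof -
  have "bilinear (\<omega> p)" using assms by (simp add: smooth_bilin_def)
  then show ?thesis
    using assms by (simp add: cov_bilin_def bilin_tensor_def coordinate_connection_def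
        dfun_eqI[OF has_derivative_bilin_field[OF assms(2-4)]] bilinear_ladd bilinear_radd)
qed

lemma coord_deriv_cong:
  assumes "local_field A p Y" "open V" "p \<in> V" "\<And>q. q \<in> V \<Longrightarrow> Y q = Z q"
  shows "coord_deriv A p v Z = coord_deriv A p v Y"
proof -
  let ?c = "chart_at A p"
  have "(field_rep A ?c Z has_derivative (\<lambda>v. coord_deriv A p v Y)) (at (snd ?c p))"
    by (rule has_derivative_transform_within_open[OF local_field_has_derivative[OF assms(1)]
          open_chart_image[OF chart_at_in assms(2)]])
      (use assms in auto)
  then show ?thesis unfolding coord_deriv_def[of A p v Z] by (simp add: frechet_derivative_eqI)
qed

lemma coord_deriv_uminus:
  assumes "local_field A p Y"
  shows "coord_deriv A p v (\<lambda>q. - Y q) = - coord_deriv A p v Y"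
proof -
  let ?c = "chart_at A p"
  have "(field_rep A ?c (\<lambda>q. - Y q) has_derivative (\<lambda>v. - coord_deriv A p v Y)) (at (snd ?c p))"
    by (rule has_derivative_transform_within_open[OF has_derivative_minus[OF local_field_has_derivative[OF assms]],
          of "snd ?c ` fst ?c"])
      (auto simp: open_chart_image_subset open_chart linear_neg[OF linear_vec_to_chart])
  then show ?thesis unfolding coord_deriv_def[of A p v "\<lambda>q. - Y q"] by (simp add: frechet_derivative_eqI)
qed

lemma endo_tensor_comp:
  assumes J: "smooth_endo A U J" and K: "smooth_endo A U K" and L: "smooth_endo A U L"
    and U: "open U" "p \<in> U" and JK: "\<And>q v. q \<in> U \<Longrightarrow> J q (K q v) = L q v"
  shows "endo_tensor A D L p v y = endo_tensor A D J p v (K p y) + J p (endo_tensor A D K p v y)"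
proof -
  obtain Y where Y: "local_field A p Y" "Y p = y" using local_field_exists by blast
  have KY: "local_field A p (\<lambda>q. K q (Y q))" by (rule local_field_smooth_endo[OF K U Y(1)])
  have JKY: "local_field A p (\<lambda>q. J q (K q (Y q)))" by (rule local_field_smooth_endo[OF J U KY])
  have "coord_deriv A p v (\<lambda>q. L q (Y q)) = coord_deriv A p v (\<lambda>q. J q (K q (Y q)))"
    by (rule coord_deriv_cong[OF JKY U]) (simp add: JK)
  moreover have "linear (J p)" using J U by (simp add: smooth_endo_def)
  ultimately show ?thesis
    unfolding endo_tensor_def coord_deriv_endo[OF L U Y(1)] coord_deriv_endo[OF J U KY]
      coord_deriv_endo[OF K U Y(1)] Y(2)
    using JK[OF U(2)] by (simp add: linear_add linear_diff algebra_simps)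
qed

lemma endo_tensor_square:
  assumes J: "smooth_endo A U J" and U: "open U" "p \<in> U" and JJ: "\<And>q v. q \<in> U \<Longrightarrow> J q (J q v) = - v"
  shows "endo_tensor A D J p v (J p y) = - J p (endo_tensor A D J p v y)"
proof -
  obtain Y where Y: "local_field A p Y" "Y p = y" using local_field_exists by blast
  have JY: "local_field A p (\<lambda>q. J q (Y q))" by (rule local_field_smooth_endo[OF J U Y(1)])
  have JJY: "local_field A p (\<lambda>q. J q (J q (Y q)))" by (rule local_field_smooth_endo[OF J U JY])
  have "- coord_deriv A p v Y = coord_deriv A p v (\<lambda>q. J q (J q (Y q)))"
    unfolding coord_deriv_uminus[OF Y(1), symmetric]
    by (rule coord_deriv_cong[OF JJY U]) (simp add: JJ)
  moreover have lJ: "linear (J p)" using J U by (simp add: smooth_endo_def)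
  ultimately have "endo_deriv A J p v (J p y) = - J p (endo_deriv A J p v y)"
    unfolding coord_deriv_endo[OF J U JY] coord_deriv_endo[OF J U Y(1)] Y(2)
    by (simp add: linear_add JJ[OF U(2)] eq_neg_iff_add_eq_0)
  then show ?thesis
    by (simp add: endo_tensor_def JJ[OF U(2)] linear_add[OF lJ] linear_diff[OF lJ]
        linear_neg[OF linear_christoffel])
qed

end

section \<open>Admissible bases and the adapted connection\<close>

lemma nondegenerate_form_represents:
  fixes \<beta> :: "'a::euclidean_space \<Rightarrow> 'a \<Rightarrow> real"
  assumes bil: "bilinear \<beta>" and nondeg: "\<And>v. (\<And>w. \<beta> v w = 0) \<Longrightarrow> v = 0" and "linear \<phi>"
  shows "\<exists>!u. \<forall>w. \<beta> u w = \<phi> w"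
proof (rule ex_ex1I)
  have l: "linear (\<beta> u)" "linear (\<lambda>u. \<beta> u w)" for u w
    using bil by (auto simp: bilinear_def)
  have expand: "\<psi> w = (\<Sum>b\<in>Basis. (w \<bullet> b) *\<^sub>R \<psi> b)" if "linear \<psi>" for \<psi> :: "'a \<Rightarrow> real" and w
    using linear_basis_sum[OF that] by simp
  define L where "L u = (\<Sum>b\<in>Basis. \<beta> u b *\<^sub>R b)" for u
  have L: "linear L"
    unfolding L_def
    by (intro linearI) (simp_all add: bilinear_ladd[OF bil] bilinear_lmul[OF bil] scaleR_add_left
        sum.distrib scaleR_sum_right)
  have Lb: "L u \<bullet> b = \<beta> u b" if "b \<in> Basis" for u b
    unfolding L_def using that by simp
  have "u = 0" if "L u = 0" for u
  proof (rule nondeg)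
    fix w
    have "\<beta> u b = 0" if "b \<in> Basis" for b using Lb[OF that, of u] \<open>L u = 0\<close> by simp
    then show "\<beta> u w = 0" using expand[OF l(1)[of u], of w] by simp
  qed
  then have "inj L" using linear_injective_0[OF L] by blast
  then obtain u where u: "L u = (\<Sum>b\<in>Basis. \<phi> b *\<^sub>R b)"
    using linear_injective_imp_surjective[OF L] by (metis surjD)
  have "\<beta> u b = \<phi> b" if "b \<in> Basis" for b
    using Lb[OF that, of u] that by (simp add: u)
  then have "\<beta> u w = \<phi> w" for w
    using expand[OF l(1)[of u], of w] expand[OF assms(3), of w] by simp
  then show "\<exists>u. \<forall>w. \<beta> u w = \<phi> w" by blast
next
  fix u v assume "\<forall>w. \<beta> u w = \<phi> w" "\<forall>w. \<beta> v w = \<phi> w"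
  then have "u - v = 0" by (intro nondeg) (simp add: bilinear_lsub[OF bil])
  then show "u = v" by simp
qed

lemma mod_3_numerals: "(4 :: 3) = 1" "(5 :: 3) = 2"
  by simp_all

locale admissible = manifold A
  for A :: "('m::{t2_space,second_countable_topology}, 'e::euclidean_space) atlas" +
  fixes Q :: "'m \<Rightarrow> ('e \<Rightarrow> 'e) set" and U :: "'m set" and J :: "3 \<Rightarrow> 'm \<Rightarrow> 'e \<Rightarrow> 'e"
  assumes basis: "admissible_basis A Q U J"
begin

lemma open_U: "open U" and smooth_J: "smooth_endo A U (J a)"
  using basis by (simp_all add: admissible_basis_def)

lemma linear_J: "q \<in> U \<Longrightarrow> linear (J a q)"
  using smooth_J by (simp add: smooth_endo_def)

lemma J_square: "q \<in> U \<Longrightarrow> J a q (J a q v) = - v"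
  using basis by (simp add: admissible_basis_def)

lemma J_products:
  assumes "q \<in> U"
  shows "J 1 q (J 2 q v) = J 3 q v" "J 2 q (J 1 q v) = - J 3 q v"
    "J 2 q (J 3 q v) = J 1 q v" "J 3 q (J 2 q v) = - J 1 q v"
    "J 3 q (J 1 q v) = J 2 q v" "J 1 q (J 3 q v) = - J 2 q v"
proof -
  have 12: "J 1 q (J 2 q v) = J 3 q v" and 21: "J 2 q (J 1 q v) = - J 3 q v" for v
    using basis assms by (auto simp: admissible_basis_def)
  show "J 1 q (J 2 q v) = J 3 q v" "J 2 q (J 1 q v) = - J 3 q v"
    by (fact 12, fact 21)
  show "J 3 q (J 2 q v) = - J 1 q v"
    using 12[of "J 2 q v"] by (simp add: J_square assms linear_neg[OF linear_J[OF assms]])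
  show "J 1 q (J 3 q v) = - J 2 q v"
    using 12[of v] J_square[OF assms, of 1 "J 2 q v"] by simp
  show "J 3 q (J 1 q v) = J 2 q v"
    using 21[of "J 1 q v"] by (simp add: J_square assms linear_neg[OF linear_J[OF assms]])
  show "J 2 q (J 3 q v) = J 1 q v"
    using 21[of v] J_square[OF assms, of 2 "J 1 q v"]
    by (simp add: linear_neg[OF linear_J[OF assms]])
qed

lemma J_independent:
  assumes "q \<in> U" "y \<noteq> 0"
    and 0: "t *\<^sub>R y + x *\<^sub>R J 1 q y + r *\<^sub>R J 2 q y + s *\<^sub>R J 3 q y = 0"
  shows "t = 0 \<and> x = 0 \<and> r = 0 \<and> s = 0"
proof -
  define w where "w = t *\<^sub>R y + x *\<^sub>R J 1 q y + r *\<^sub>R J 2 q y + s *\<^sub>R J 3 q y"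
  have "t *\<^sub>R w - x *\<^sub>R J 1 q w - r *\<^sub>R J 2 q w - s *\<^sub>R J 3 q w = (t\<^sup>2 + x\<^sup>2 + r\<^sup>2 + s\<^sup>2) *\<^sub>R y"
    unfolding w_def
    by (simp add: linear_add[OF linear_J[OF assms(1)]] linear_scale[OF linear_J[OF assms(1)]]
        J_square[OF assms(1)] J_products[OF assms(1)] algebra_simps power2_eq_square)
  moreover have "w = 0" using 0 by (simp add: w_def)
  ultimately have "t\<^sup>2 + x\<^sup>2 + r\<^sup>2 + s\<^sup>2 = 0"
    using assms(2) linear_0[OF linear_J[OF assms(1)]] by simp
  then show ?thesis
    using zero_le_power2[of t] zero_le_power2[of x] zero_le_power2[of r] zero_le_power2[of s]
    by (smt (verit) power2_eq_square zero_less_mult_iff not_real_square_gt_zero)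
qed

lemma in_Q: "q \<in> U \<Longrightarrow> J a q \<in> Q q"
proof -
  assume q: "q \<in> U"
  have "(\<Sum>b\<in>UNIV. (if b = a then 1 else 0) *\<^sub>R J b q v) = J a q v" for v
    by (subst sum.remove[of _ a]) auto
  then have "J a q = (\<lambda>v. \<Sum>b\<in>UNIV. (if b = a then 1 else 0) *\<^sub>R J b q v)" by simp
  then have "J a q \<in> range (\<lambda>x :: 3 \<Rightarrow> real. \<lambda>v. \<Sum>a\<in>UNIV. x a *\<^sub>R J a q v)"
    by (rule range_eqI[where x = "\<lambda>b. if b = a then 1 else 0"])
  then show ?thesis using basis q by (simp add: admissible_basis_def)
qed

lemma in_Q_expand: "q \<in> U \<Longrightarrow> L \<in> Q q \<Longrightarrow> \<exists>x. \<forall>y. L y = (\<Sum>b\<in>UNIV. x b *\<^sub>R J b q y)"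
  using basis by (auto simp: admissible_basis_def)

lemma endo_tensor_J:
  assumes D: "coordinate_connection A D" "preserves_Q A Q D" and p: "p \<in> U"
  obtains \<gamma> where "\<And>a y. endo_tensor A D (J a) p v y = \<gamma> (a + 2) *\<^sub>R J (a + 1) p y - \<gamma> (a + 1) *\<^sub>R J (a + 2) p y"
proof -
  let ?K = "\<lambda>a. endo_tensor A D (J a) p v"
  have "\<exists>x. \<forall>y. ?K a y = (\<Sum>b\<in>UNIV. x b *\<^sub>R J b p y)" for a
  proof -
    obtain L where L: "L \<in> Q p" "\<And>Y. local_field A p Y \<Longrightarrow> cov_endo D (J a) p v Y = L (Y p)"
      using D(2)[unfolded preserves_Q_def, rule_format, of U "J a" p v] open_U smooth_J[of a] in_Q p
      by blast
    have "?K a y = L y" for y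
    proof -
      obtain Y where "local_field A p Y" "Y p = y" using local_field_exists by blast
      then show ?thesis
        using L(2) cov_endo_coordinate[OF D(1) smooth_J open_U p] by metis
    qed
    then show ?thesis using in_Q_expand[OF p L(1)] by simp
  qed
  then obtain l where l: "\<And>a y. ?K a y = (\<Sum>b\<in>UNIV. l a b *\<^sub>R J b p y)"
    using choice[of "\<lambda>a x. \<forall>y. ?K a y = (\<Sum>b\<in>UNIV. x b *\<^sub>R J b p y)"] by blast
  have K: "?K a y = l a 1 *\<^sub>R J 1 p y + l a 2 *\<^sub>R J 2 p y + l a 3 *\<^sub>R J 3 p y" for a y
    unfolding l sum_3 ..
  obtain y :: 'e where y: "y \<noteq> 0" using nonempty_Basis nonzero_Basis by blast
  note lin = linear_add[OF linear_J[OF p]] linear_scale[OF linear_J[OF p]] linear_neg[OF linear_J[OF p]]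
  have sq: "?K a (J a p y) + J a p (?K a y) = 0" for a
    using endo_tensor_square[OF smooth_J open_U p J_square] by simp
  have half: "w = 0" if "- w = w" for w :: 'e
  proof -
    have "2 *\<^sub>R w = 0" using that by (metis scaleR_2 add.right_inverse)
    then show ?thesis by simp
  qed
  have "l 1 1 *\<^sub>R y = 0" "l 2 2 *\<^sub>R y = 0" "l 3 3 *\<^sub>R y = 0"
    by (rule half; use sq[of 1] sq[of 2] sq[of 3] in
        \<open>simp add: K lin J_square[OF p] J_products[OF p]\<close>)+
  then have diag: "l 1 1 = 0" "l 2 2 = 0" "l 3 3 = 0" using y by simp_all
  have "?K 3 y = ?K 1 (J 2 p y) + J 1 p (?K 2 y)"
    by (rule endo_tensor_comp[OF smooth_J smooth_J smooth_J open_U p J_products(1)])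
  then have "(l 1 2 + l 2 1) *\<^sub>R y + (l 3 1 + l 1 3) *\<^sub>R J 1 p y + (l 3 2 + l 2 3) *\<^sub>R J 2 p y + 0 *\<^sub>R J 3 p y = 0"
    unfolding K diag by (simp add: lin J_square[OF p] J_products[OF p] algebra_simps)
  then have anti: "l 2 1 = - l 1 2" "l 3 1 = - l 1 3" "l 3 2 = - l 2 3"
    using J_independent[OF p y] by (smt (verit))+
  define \<gamma> where "\<gamma> a = (if a = 1 then l 2 3 else if a = 2 then - l 1 3 else l 1 2)" for a :: 3
  have "?K a y = \<gamma> (a + 2) *\<^sub>R J (a + 1) p y - \<gamma> (a + 1) *\<^sub>R J (a + 2) p y" for a y
    using exhaust_3[of a] by (elim disjE; hypsubst; simp add: \<gamma>_def K diag anti mod_3_numerals)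
  then show thesis by (rule that)
qed

lemma endo_tensor_conn_forms:
  assumes D: "coordinate_connection A D" and p: "p \<in> U"
    and \<gamma>: "\<And>a y. endo_tensor A D (J a) p v y = \<gamma> (a + 2) *\<^sub>R J (a + 1) p y - \<gamma> (a + 1) *\<^sub>R J (a + 2) p y"
  shows "conn_forms A D J p v = \<gamma>"
  unfolding conn_forms_def
proof (rule the_equality)
  fix \<delta>
  assume \<delta>: "\<forall>a Y. local_field A p Y \<longrightarrow>
    cov_endo D (J a) p v Y = \<delta> (a + 2) *\<^sub>R J (a + 1) p (Y p) - \<delta> (a + 1) *\<^sub>R J (a + 2) p (Y p)"
  obtain y :: 'e where y: "y \<noteq> 0" using nonempty_Basis nonzero_Basis by blast
  obtain Y where Y: "local_field A p Y" "Y p = y" using local_field_exists by blast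
  have eq: "\<delta> (a + 2) *\<^sub>R J (a + 1) p y - \<delta> (a + 1) *\<^sub>R J (a + 2) p y
      = \<gamma> (a + 2) *\<^sub>R J (a + 1) p y - \<gamma> (a + 1) *\<^sub>R J (a + 2) p y" for a
    using \<delta> Y cov_endo_coordinate[OF D smooth_J open_U p Y(1)] \<gamma> by metis
  have "0 *\<^sub>R y + 0 *\<^sub>R J 1 p y + (\<delta> 3 - \<gamma> 3) *\<^sub>R J 2 p y + (\<gamma> 2 - \<delta> 2) *\<^sub>R J 3 p y = 0"
    using eq[of 1] by (simp add: algebra_simps)
  moreover have "0 *\<^sub>R y + (\<gamma> 3 - \<delta> 3) *\<^sub>R J 1 p y + 0 *\<^sub>R J 2 p y + (\<delta> 1 - \<gamma> 1) *\<^sub>R J 3 p y = 0"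
    using eq[of 2] mod_3_numerals by (simp add: algebra_simps)
  ultimately have "\<delta> 1 = \<gamma> 1" "\<delta> 2 = \<gamma> 2" "\<delta> 3 = \<gamma> 3"
    using J_independent[OF p y] by (metis eq_iff_diff_eq_0)+
  then have "\<delta> a = \<gamma> a" for a
    using exhaust_3[of a] by (elim disjE) simp_all
  then show "\<delta> = \<gamma>" by (rule ext)
qed (use cov_endo_coordinate[OF D smooth_J open_U p] \<gamma> in auto)

end

locale qsH_connection = manifold A
  for A :: "('m::{t2_space,second_countable_topology}, 'e::euclidean_space) atlas" +
  fixes Q :: "'m \<Rightarrow> ('e \<Rightarrow> 'e) set" and \<omega> :: "'m \<Rightarrow> 'e \<Rightarrow> 'e \<Rightarrow> real" and D :: "('m, 'e) conn"
  assumes qsH: "almost_qsH A Q \<omega>" and D: "coordinate_connection A D" and D_Q: "preserves_Q A Q D"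
begin

abbreviation "DQ \<equiv> adapted_connection A \<omega> D"

lemma smooth_form: "smooth_bilin A \<omega>" and form_antisym: "\<omega> q v w = - \<omega> q w v"
  using qsH unfolding almost_qsH_def by blast+

lemma bilinear_form: "bilinear (\<omega> q)"
  using smooth_form by (simp add: smooth_bilin_def)

lemma form_nondegenerate: "(\<And>w. \<omega> q v w = 0) \<Longrightarrow> v = 0"
  using qsH unfolding almost_qsH_def nondegenerate_def by blast

lemma form_eqI: "(\<And>w. \<omega> q u w = \<omega> q v w) \<Longrightarrow> u = v"
  using form_nondegenerate[of q "u - v"] by (simp add: bilinear_lsub[OF bilinear_form])

definition correction :: "'m \<Rightarrow> 'e \<Rightarrow> 'e \<Rightarrow> 'e" where
  "correction p v y = (THE u. \<forall>z. \<omega> p u z = bilin_tensor A D \<omega> p v y z / 2)"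

lemma correction: "\<omega> p (correction p v y) z = bilin_tensor A D \<omega> p v y z / 2"
proof -
  have "linear (\<lambda>z. bilin_tensor A D \<omega> p v y z / 2)"
    using linear_bilin_tensor(1)[where \<omega> = \<omega> and p = p, OF bilinear_form, of A D v y]
    by (simp add: linear_iff add_divide_distrib)
  then have "\<exists>!u. \<forall>z. \<omega> p u z = bilin_tensor A D \<omega> p v y z / 2"
    using form_nondegenerate by (intro nondegenerate_form_represents[OF bilinear_form]) blast+
  from theI'[OF this] show ?thesis unfolding correction_def by blast
qed

lemma linear_correction: "linear (correction p v)"
proof (rule linearI; rule form_eqI[of p])
  show "\<omega> p (correction p v (x + y)) w = \<omega> p (correction p v x + correction p v y) w" for x y w
    using linear_add[OF linear_bilin_tensor(2)[where \<omega> = \<omega> and p = p, OF bilinear_form]]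
    by (simp add: bilinear_ladd[OF bilinear_form] correction add_divide_distrib)
  show "\<omega> p (correction p v (c *\<^sub>R x)) w = \<omega> p (c *\<^sub>R correction p v x) w" for c x w
    using linear_scale[OF linear_bilin_tensor(2)[where \<omega> = \<omega> and p = p, OF bilinear_form]]
    by (simp add: bilinear_lmul[OF bilinear_form] correction)
qed

lemma DQ_eq:
  assumes "local_field A p Y"
  shows "DQ p v Y = D p v Y + correction p v (Y p)"
proof -
  have "(\<forall>Z. local_field A p Z \<longrightarrow> \<omega> p u (Z p) = cov_bilin A D \<omega> p v Y Z / 2)
      \<longleftrightarrow> (\<forall>z. \<omega> p u z = bilin_tensor A D \<omega> p v (Y p) z / 2)" for u
    using cov_bilin_coordinate[OF D smooth_form assms] local_field_exists by metis
  then show ?thesis by (simp add: adapted_connection_def correction_def)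
qed

lemma christoffel_DQ: "christoffel A DQ p v y = christoffel A D p v y + correction p v y"
  using linear_basis_sum[OF linear_correction]
  by (simp add: christoffel_def DQ_eq scaleR_add_right sum.distrib)

lemma DQ_coordinate: "coordinate_connection A DQ"
  using D by (auto simp: coordinate_connection_def DQ_eq christoffel_DQ)

lemma bilin_tensor_antisym: "bilin_tensor A D \<omega> p v y z = - bilin_tensor A D \<omega> p v z y"
proof -
  have "dfun A (\<lambda>q. \<omega> q (X q) (Y q)) p v = - dfun A (\<lambda>q. \<omega> q (Y q) (X q)) p v"
    if "local_field A p X" "local_field A p Y" for X Y
  proof -
    have "((\<lambda>q. \<omega> q (X q) (Y q)) \<circ> chart_inv (chart_at A p))
        = (\<lambda>x. - ((\<lambda>q. \<omega> q (Y q) (X q)) \<circ> chart_inv (chart_at A p)) x)"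
      unfolding o_def by (rule ext, rule form_antisym)
    then show ?thesis
      using has_derivative_minus[OF has_derivative_bilin_field[OF smooth_form that(2,1)]]
      by (simp add: dfun_eqI[OF has_derivative_bilin_field[OF smooth_form that(2,1)]] dfun_eqI)
  qed
  note d = this
  have anti: "cov_bilin A D \<omega> p v X Y = - cov_bilin A D \<omega> p v Y X"
    if "local_field A p X" "local_field A p Y" for X Y
    unfolding cov_bilin_def d[OF that]
    using form_antisym[of p "D p v X" "Y p"] form_antisym[of p "X p" "D p v Y"] by simp
  obtain Y Z where "local_field A p Y" "Y p = y" "local_field A p Z" "Z p = z"
    using local_field_exists by meson
  then show ?thesis
    using anti cov_bilin_coordinate[OF D smooth_form] by metis
qed

lemma DQ_preserves_form: "bilin_tensor A DQ \<omega> p v y z = 0"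
proof -
  have "bilin_tensor A DQ \<omega> p v y z
      = bilin_tensor A D \<omega> p v y z - \<omega> p (correction p v y) z - \<omega> p y (correction p v z)"
    by (simp add: bilin_tensor_def christoffel_DQ bilinear_ladd[OF bilinear_form]
        bilinear_radd[OF bilinear_form])
  also have "\<dots> = 0"
    using form_antisym[of p y "correction p v z"] bilin_tensor_antisym[of p v z y]
    by (simp add: correction)
  finally show ?thesis .
qed

end

locale qsH_basis = qsH_connection A Q \<omega> D + admissible A Q U J
  for A :: "('m::{t2_space,second_countable_topology}, 'e::euclidean_space) atlas" and Q \<omega> D U J
begin

lemma form_J: "q \<in> U \<Longrightarrow> \<omega> q (J a q v) (J a q w) = \<omega> q v w"
  using qsH basis unfolding almost_qsH_def by blast

lemma form_J_skew: "q \<in> U \<Longrightarrow> \<omega> q (J a q v) w = - \<omega> q v (J a q w)"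
  using form_J[of q a v "J a q w"] by (simp add: J_square bilinear_rneg[OF bilinear_form])

lemma bilin_tensor_J:
  assumes p: "p \<in> U"
  shows "bilin_tensor A D \<omega> p v (J a p y) (J a p z) = bilin_tensor A D \<omega> p v y z"
proof -
  obtain Y Z where Y: "local_field A p Y" "Y p = y" and Z: "local_field A p Z" "Z p = z"
    using local_field_exists by meson
  have JY: "local_field A p (\<lambda>q. J a q (Y q))" and JZ: "local_field A p (\<lambda>q. J a q (Z q))"
    by (rule local_field_smooth_endo[OF smooth_J open_U p Y(1)],
        rule local_field_smooth_endo[OF smooth_J open_U p Z(1)])
  have "dfun A (\<lambda>q. \<omega> q (J a q (Y q)) (J a q (Z q))) p v = dfun A (\<lambda>q. \<omega> q (Y q) (Z q)) p v"
    unfolding dfun_eqI[OF has_derivative_bilin_field[OF smooth_form Y(1) Z(1)]]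
    by (rule dfun_eqI, rule has_derivative_locally_eq[OF has_derivative_bilin_field[OF smooth_form Y(1) Z(1)] _ _ open_U p])
      (auto simp: form_J)
  moreover
  let ?K = "endo_tensor A D (J a) p v"
  have DJ: "D p v (\<lambda>q. J a q (Y q)) = ?K (Y p) + J a p (D p v Y)" if "local_field A p Y" for Y
    using cov_endo_coordinate[OF D smooth_J open_U p that] by (simp add: cov_endo_def algebra_simps)
  obtain \<gamma> where \<gamma>: "\<And>a y. endo_tensor A D (J a) p v y = \<gamma> (a + 2) *\<^sub>R J (a + 1) p y - \<gamma> (a + 1) *\<^sub>R J (a + 2) p y"
    using endo_tensor_J[OF D D_Q p] by blast
  have "\<omega> p (J b p y) (J a p z) + \<omega> p (J a p y) (J b p z) = 0" if "a \<noteq> b" for b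
    using exhaust_3[of a] exhaust_3[of b]
    by (elim disjE; hypsubst; use that in simp; simp add: form_J_skew[OF p] J_products[OF p] bilinear_rneg[OF bilinear_form])
  then have e: "\<omega> p (J b p y) (J a p z) = - \<omega> p (J a p y) (J b p z)" if "a \<noteq> b" for b
    using that by (simp add: eq_neg_iff_add_eq_0)
  have ne: "a \<noteq> a + 1" "a \<noteq> a + 2" by simp_all
  have "\<omega> p (?K y) (J a p z) + \<omega> p (J a p y) (?K z) = 0"
    by (simp only: \<gamma> bilinear_lsub[OF bilinear_form] bilinear_rsub[OF bilinear_form]
      bilinear_lmul[OF bilinear_form] bilinear_rmul[OF bilinear_form] e[OF ne(1)] e[OF ne(2)]) simp
  ultimately have "cov_bilin A D \<omega> p v (\<lambda>q. J a q (Y q)) (\<lambda>q. J a q (Z q)) = cov_bilin A D \<omega> p v Y Z"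
    by (simp add: cov_bilin_def DJ Y Z bilinear_ladd[OF bilinear_form] bilinear_radd[OF bilinear_form]
        form_J[OF p])
  then show ?thesis
    by (simp add: cov_bilin_coordinate[OF D smooth_form] Y Z JY JZ)
qed

lemma correction_J:
  assumes "p \<in> U"
  shows "correction p v (J a p y) = J a p (correction p v y)"
proof (rule form_eqI[of p])
  fix w
  have w: "w = J a p (- J a p w)" using assms by (simp add: linear_neg[OF linear_J] J_square)
  have "\<omega> p (correction p v (J a p y)) (J a p z) = \<omega> p (J a p (correction p v y)) (J a p z)" for z
    using assms by (simp add: correction bilin_tensor_J form_J)
  from this[of "- J a p w"] w
  show "\<omega> p (correction p v (J a p y)) w = \<omega> p (J a p (correction p v y)) w" by simp
qed

lemma endo_tensor_DQ:
  assumes p: "p \<in> U"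
  shows "endo_tensor A DQ (J 1) p v y
    = conn_forms A DQ J p v 3 *\<^sub>R J 2 p y - conn_forms A DQ J p v 2 *\<^sub>R J 3 p y"
proof -
  obtain \<gamma> where \<gamma>: "\<And>a y. endo_tensor A D (J a) p v y = \<gamma> (a + 2) *\<^sub>R J (a + 1) p y - \<gamma> (a + 1) *\<^sub>R J (a + 2) p y"
    using endo_tensor_J[OF D D_Q p] by blast
  have DQ: "endo_tensor A DQ (J a) p v y = endo_tensor A D (J a) p v y" for a y
    by (simp add: endo_tensor_def christoffel_DQ correction_J[OF p] linear_add[OF linear_J[OF p]])
  have "conn_forms A DQ J p v = \<gamma>"
    by (rule endo_tensor_conn_forms[OF DQ_coordinate p]) (simp add: DQ \<gamma>)
  then show ?thesis using \<gamma>[of 1 y] by (simp add: DQ)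
qed

end

section \<open>Submanifolds and the induced connection\<close>

locale qsH_submanifold = qsH_connection A Q \<omega> D + N: manifold B
  for A :: "('m::{t2_space,second_countable_topology}, 'e::euclidean_space) atlas"
    and Q \<omega> D
    and B :: "('p::{t2_space,second_countable_topology}, 'f::euclidean_space) atlas" +
  fixes i :: "'p \<Rightarrow> 'm" and Jh :: "'p \<Rightarrow> 'f \<Rightarrow> 'f"
  assumes submanifold: "almost_pseudo_Hermitian_submanifold A Q \<omega> B i Jh"
begin

abbreviation "T \<equiv> tmap B A i"

abbreviation chart_map :: "'p \<Rightarrow> 'f \<Rightarrow> 'e" where
  "chart_map p \<equiv> snd (chart_at A (i p)) \<circ> i \<circ> chart_inv (chart_at B p)"

abbreviation chart_point :: "'p \<Rightarrow> 'f" where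
  "chart_point p \<equiv> snd (chart_at B p) p"

definition chart_dom :: "'p \<Rightarrow> 'f set" where
  "chart_dom p = snd (chart_at B p) ` (fst (chart_at B p) \<inter> i -` fst (chart_at A (i p)))"

lemma immersion: "immersion B A i"
  using submanifold by (simp add: almost_pseudo_Hermitian_submanifold_def almost_complex_submanifold_def)

lemma open_vimage_i: "open V \<Longrightarrow> open (i -` V)"
  using immersion by (simp add: immersion_def continuous_on_open_vimage)

lemma smooth_Jh: "smooth_endo B UNIV Jh"
  using submanifold by (simp add: almost_pseudo_Hermitian_submanifold_def
      almost_complex_submanifold_def almost_complex_structure_def)

lemma Jh_square: "Jh p (Jh p v) = - v"
  using submanifold by (simp add: almost_pseudo_Hermitian_submanifold_def
      almost_complex_submanifold_def almost_complex_structure_def)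

lemma linear_Jh: "linear (Jh p)"
  using smooth_Jh by (simp add: smooth_endo_def)

lemma local_field_Jh: "local_field B p Y \<Longrightarrow> local_field B p (\<lambda>q. Jh q (Y q))"
  by (rule N.local_field_smooth_endo[OF smooth_Jh]) auto

lemma open_chart_dom: "open (chart_dom p)"
proof -
  have "open (fst (chart_at B p) \<inter> i -` fst (chart_at A (i p)))"
    by (intro open_Int N.open_chart open_vimage_i open_chart) auto
  then show ?thesis unfolding chart_dom_def by (intro N.open_chart_image_subset) auto
qed

lemma chart_point_in: "chart_point p \<in> chart_dom p"
  unfolding chart_dom_def by (rule imageI) simp

lemma smooth_chart_map: "smooth_on (chart_dom p) (chart_map p)"
  using immersion unfolding immersion_def chart_dom_def by (simp add: o_assoc)

lemma has_derivative_chart_map: "(chart_map p has_derivative T p) (at (chart_point p))"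
  using smooth_on_has_derivative[OF smooth_chart_map chart_point_in]
  by (simp add: tmap_def[abs_def])

lemma chart_map_point: "chart_map p (chart_point p) = snd (chart_at A (i p)) (i p)"
  by simp

lemma linear_T: "linear (T p)"
  using has_derivative_chart_map has_derivative_linear by blast

lemma tmap_in_charts:
  assumes "b \<in> B" "c \<in> A" "q \<in> fst b" "i q \<in> fst c"
  shows "vec_to_chart A c (i q) (T q v)
    = frechet_derivative (snd c \<circ> i \<circ> chart_inv b) (at (snd b q)) (vec_to_chart B b q v)"
proof -
  let ?c = "chart_at A (i q)" and ?b = "chart_at B q"
  have 1: "((snd ?c \<circ> i) \<circ> chart_inv b has_derivative (\<lambda>v. T q (jac b ?b q v))) (at (snd b q))"
    by (rule N.has_derivative_change_chart[of b ?b q "snd ?c \<circ> i" "T q"])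
      (use assms has_derivative_chart_map[of q] in simp_all)
  have "((snd c \<circ> chart_inv ?c) \<circ> ((snd ?c \<circ> i) \<circ> chart_inv b) has_derivative
      jac ?c c (i q) \<circ> (\<lambda>v. T q (jac b ?b q v))) (at (snd b q))"
    using assms has_derivative_jac[of ?c c "i q"] by (intro diff_chain_at 1) auto
  then have "((\<lambda>q. snd c (chart_inv ?c (snd ?c (i q)))) \<circ> chart_inv b has_derivative
      (\<lambda>v. jac ?c c (i q) (T q (jac b ?b q v)))) (at (snd b q))"
    by (simp add: o_def)
  then have "(snd c \<circ> i \<circ> chart_inv b has_derivative
      (\<lambda>v. jac ?c c (i q) (T q (jac b ?b q v)))) (at (snd b q))"
    by (rule N.has_derivative_locally_eq[where V = "i -` fst ?c"])
      (use assms in \<open>auto intro: open_vimage_i open_chart\<close>)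
  then show ?thesis
    using assms by (simp add: frechet_derivative_eqI vec_to_chart_jac N.jac_comp N.jac_self)
qed

definition hess :: "'p \<Rightarrow> 'f \<Rightarrow> 'f \<Rightarrow> 'e" where
  "hess p v w = (\<Sum>b\<in>Basis. (w \<bullet> b) *\<^sub>R
     frechet_derivative (\<lambda>y. frechet_derivative (chart_map p) (at y) b) (at (chart_point p)) v)"

lemma hess_symmetric: "hess p v w = hess p w v"
proof -
  let ?H = "\<lambda>b v. frechet_derivative (\<lambda>y. frechet_derivative (chart_map p) (at y) b) (at (chart_point p)) v"
  have "linear (?H b)" for b
    using smooth_on_has_derivative[OF smooth_on_frechet_derivative[OF smooth_chart_map] chart_point_in]
      has_derivative_linear by blast
  from linear_basis_sum[OF this]
  have H: "hess p v w = (\<Sum>b\<in>Basis. \<Sum>c\<in>Basis. (w \<bullet> b) *\<^sub>R (v \<bullet> c) *\<^sub>R ?H b c)" for v w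
    unfolding hess_def scaleR_sum_right[symmetric] by simp
  have "?H b c = ?H c b" for b c
    by (rule symmetric_second_derivative[OF open_chart_dom smooth_chart_map chart_point_in])
  then show ?thesis
    unfolding H by (subst sum.swap) (simp add: mult.commute)
qed

definition along_deriv :: "'p \<Rightarrow> 'f \<Rightarrow> ('p \<Rightarrow> 'f) \<Rightarrow> 'e" where
  "along_deriv p v Y = hess p v (Y p) + T p (coord_deriv B p v Y)"

definition along_rep :: "'p \<Rightarrow> ('p \<Rightarrow> 'e) \<Rightarrow> 'f \<Rightarrow> 'e" where
  "along_rep p Z = (\<lambda>q. vec_to_chart A (chart_at A (i p)) (i q) (Z q)) \<circ> chart_inv (chart_at B p)"

lemma along_rep_point [simp]: "along_rep p Z (chart_point p) = Z p"
  by (simp add: along_rep_def)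

lemma along_rep_has_derivative:
  assumes "local_field B p Y"
  shows "(along_rep p (\<lambda>q. T q (Y q)) has_derivative (\<lambda>v. along_deriv p v Y)) (at (chart_point p))"
proof (rule has_derivative_transform_within_open[OF _ open_chart_dom chart_point_in])
  let ?b = "chart_at B p" and ?c = "chart_at A (i p)"
  let ?F = "\<lambda>y. frechet_derivative (chart_map p) (at y)"
  have T: "?F (chart_point p) = T p"
    using has_derivative_chart_map by (rule frechet_derivative_eqI)
  have "((\<lambda>y. \<Sum>b\<in>Basis. (field_rep B ?b Y y \<bullet> b) *\<^sub>R ?F y b) has_derivative
      (\<lambda>v. \<Sum>b\<in>Basis. (field_rep B ?b Y (chart_point p) \<bullet> b) *\<^sub>R
          frechet_derivative (\<lambda>y. ?F y b) (at (chart_point p)) v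
        + (coord_deriv B p v Y \<bullet> b) *\<^sub>R ?F (chart_point p) b)) (at (chart_point p))"
    by (intro has_derivative_sum has_derivative_scaleR has_derivative_inner_left
        N.local_field_has_derivative[OF assms]
        smooth_on_has_derivative[OF smooth_on_frechet_derivative[OF smooth_chart_map] chart_point_in])
  also have "(\<lambda>v. \<Sum>b\<in>Basis. (field_rep B ?b Y (chart_point p) \<bullet> b) *\<^sub>R
          frechet_derivative (\<lambda>y. ?F y b) (at (chart_point p)) v
        + (coord_deriv B p v Y \<bullet> b) *\<^sub>R ?F (chart_point p) b) = (\<lambda>v. along_deriv p v Y)"
    unfolding T sum.distrib linear_basis_sum[OF linear_T] by (simp add: along_deriv_def hess_def)
  finally show "((\<lambda>y. \<Sum>b\<in>Basis. (field_rep B ?b Y y \<bullet> b) *\<^sub>R ?F y b) has_derivative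
      (\<lambda>v. along_deriv p v Y)) (at (chart_point p))" .
  fix y assume y: "y \<in> chart_dom p"
  then obtain q where q: "q \<in> fst ?b" "i q \<in> fst ?c" "y = snd ?b q"
    by (auto simp: chart_dom_def)
  have "(\<Sum>b\<in>Basis. (field_rep B ?b Y y \<bullet> b) *\<^sub>R ?F y b) = ?F y (field_rep B ?b Y y)"
    by (rule frechet_derivative_basis[OF smooth_on_differentiable[OF smooth_chart_map y], symmetric])
  also have "\<dots> = along_rep p (\<lambda>q. T q (Y q)) y"
    using q tmap_in_charts[of ?b ?c q "Y q"] by (simp add: along_rep_def o_assoc)
  finally show "(\<Sum>b\<in>Basis. (field_rep B ?b Y y \<bullet> b) *\<^sub>R ?F y b) = along_rep p (\<lambda>q. T q (Y q)) y" .
qed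

lemma cov_along_eq:
  assumes "(along_rep p Z has_derivative z') (at (chart_point p))"
  shows "cov_along A E B i p v Z = z' v + christoffel A E (i p) (T p v) (Z p)"
proof -
  let ?c = "chart_at A (i p)"
  have "dfun B (\<lambda>q. vec_to_chart A ?c (i q) (Z q) \<bullet> b) p v = z' v \<bullet> b" for b
    using has_derivative_inner_left[OF assms, of b]
    by (intro N.dfun_eqI) (simp add: along_rep_def o_def)
  then show ?thesis
    by (simp add: cov_along_def Let_def sum.distrib christoffel_def euclidean_representation)
qed

abbreviation cov_tangent :: "'p \<Rightarrow> 'f \<Rightarrow> ('p \<Rightarrow> 'f) \<Rightarrow> 'e" where
  "cov_tangent p v Y \<equiv> cov_along A DQ B i p v (\<lambda>q. T q (Y q))"

lemma cov_tangent_eq: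
  "local_field B p Y \<Longrightarrow>
    cov_tangent p v Y = along_deriv p v Y + christoffel A DQ (i p) (T p v) (T p (Y p))"
  by (rule cov_along_eq[OF along_rep_has_derivative])

lemma cov_tangent_torsion:
  assumes "local_field B p X" "local_field B p Y"
  shows "torsion_at A DQ (i p) (T p (X p)) (T p (Y p))
    = cov_tangent p (X p) Y - cov_tangent p (Y p) X - T p (lie_bracket B X Y p)"
  using hess_symmetric[of p "X p" "Y p"]
  by (simp add: torsion_at_coordinate[OF DQ_coordinate] cov_tangent_eq assms along_deriv_def
      N.lie_bracket_coord linear_diff[OF linear_T])

lemma eventually_in_nhd:
  assumes "open V" "p \<in> V"
  shows "\<forall>\<^sub>F y in nhds (chart_point p). \<exists>q\<in>V. q \<in> fst (chart_at B p) \<and> i q \<in> fst (chart_at A (i p))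
    \<and> y = snd (chart_at B p) q"
proof -
  let ?V = "(V \<inter> i -` fst (chart_at A (i p))) \<inter> fst (chart_at B p)"
  have "open (snd (chart_at B p) ` ?V)"
    using assms(1) by (intro N.open_chart_image open_Int open_vimage_i open_chart) auto
  moreover have "chart_point p \<in> snd (chart_at B p) ` ?V"
    using assms(2) by (intro imageI) simp
  ultimately show ?thesis
    by (rule eventually_mono[OF eventually_nhds_in_open]) blast
qed

lemma dfun_induced_form:
  assumes "local_field B p Y" "local_field B p Z"
  shows "dfun B (\<lambda>q. \<omega> (i q) (T q (Y q)) (T q (Z q))) p v
    = \<omega> (i p) (cov_tangent p v Y) (T p (Z p)) + \<omega> (i p) (T p (Y p)) (cov_tangent p v Z)"
proof -
  let ?Y = "along_rep p (\<lambda>q. T q (Y q))" and ?Z = "along_rep p (\<lambda>q. T q (Z q))"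
  have "((\<lambda>q. \<omega> (i q) (T q (Y q)) (T q (Z q))) \<circ> chart_inv (chart_at B p) has_derivative
      (\<lambda>v. bilin_deriv A \<omega> (i p) (T p v) (?Y (chart_point p)) (?Z (chart_point p))
        + \<omega> (i p) (along_deriv p v Y) (?Z (chart_point p))
        + \<omega> (i p) (?Y (chart_point p)) (along_deriv p v Z))) (at (chart_point p))"
    by (rule has_derivative_bilin_along[OF smooth_form has_derivative_chart_map chart_map_point
          along_rep_has_derivative[OF assms(1)] along_rep_has_derivative[OF assms(2)]])
      (rule eventually_mono[OF eventually_in_nhd[OF open_UNIV UNIV_I]], auto simp: Let_def along_rep_def)
  then have "dfun B (\<lambda>q. \<omega> (i q) (T q (Y q)) (T q (Z q))) p v
    = bilin_deriv A \<omega> (i p) (T p v) (T p (Y p)) (T p (Z p))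
      + \<omega> (i p) (along_deriv p v Y) (T p (Z p)) + \<omega> (i p) (T p (Y p)) (along_deriv p v Z)"
    using N.dfun_eqI by simp
  then show ?thesis
    using DQ_preserves_form[of "i p" "T p v" "T p (Y p)" "T p (Z p)"]
    by (simp add: cov_tangent_eq assms bilin_tensor_def bilinear_ladd[OF bilinear_form]
        bilinear_radd[OF bilinear_form])
qed

abbreviation "P \<equiv> tangential A \<omega> B i"

lemma bilinear_induced: "bilinear (induced_form A \<omega> B i p)"
  using bilinear_form[of "i p"] linear_T[of p]
  by (auto simp: induced_form_def bilinear_def linear_iff)

lemma nondegenerate_induced: "(\<And>w. \<omega> (i p) (T p v) (T p w) = 0) \<Longrightarrow> v = 0"
  using submanifold unfolding almost_pseudo_Hermitian_submanifold_def nondegenerate_def induced_form_def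
  by blast

lemma tangential_unique: "\<exists>!x. \<forall>w. \<omega> (i p) (T p x) (T p w) = \<omega> (i p) u (T p w)"
proof -
  have "linear (\<lambda>w. \<omega> (i p) u (T p w))"
    using bilinear_form[of "i p"] linear_T[of p] by (simp add: bilinear_def linear_iff)
  then have "\<exists>!x. \<forall>w. induced_form A \<omega> B i p x w = \<omega> (i p) u (T p w)"
    using nondegenerate_induced
    by (intro nondegenerate_form_represents[OF bilinear_induced]) (auto simp: induced_form_def)
  then show ?thesis by (simp add: induced_form_def)
qed

lemma tangential_eq_The: "P p u = (THE x. \<forall>w. \<omega> (i p) (T p x) (T p w) = \<omega> (i p) u (T p w))"
proof -
  have "u - T p x \<in> normal_space A \<omega> B i p \<longleftrightarrow> (\<forall>w. \<omega> (i p) (T p x) (T p w) = \<omega> (i p) u (T p w))" for x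
    unfolding normal_space_def by (auto simp: bilinear_lsub[OF bilinear_form])
  then show ?thesis by (simp add: tangential_def)
qed

lemma form_tangential: "\<omega> (i p) (T p (P p u)) (T p w) = \<omega> (i p) u (T p w)"
  using theI'[OF tangential_unique] unfolding tangential_eq_The by blast

lemma tangential_eqI: "(\<And>w. \<omega> (i p) (T p x) (T p w) = \<omega> (i p) u (T p w)) \<Longrightarrow> P p u = x"
  unfolding tangential_eq_The by (rule the1_equality[OF tangential_unique]) blast

lemma linear_tangential: "linear (P p)"
  by (rule linearI; rule tangential_eqI)
    (simp_all add: linear_add[OF linear_T] linear_scale[OF linear_T] bilinear_ladd[OF bilinear_form]
      bilinear_lmul[OF bilinear_form] form_tangential)

lemma tangential_T [simp]: "P p (T p v) = v"
  by (rule tangential_eqI) simp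

abbreviation "DN \<equiv> induced_connection A \<omega> DQ B i"

lemma DN_eq: "DN p v Y = P p (cov_tangent p v Y)"
  by (simp add: induced_connection_def)

end

locale qsH_adapted = qsH_submanifold A Q \<omega> D B i Jh + qsH_basis A Q \<omega> D U J
  for A :: "('m::{t2_space,second_countable_topology}, 'e::euclidean_space) atlas"
    and Q \<omega> D
    and B :: "('p::{t2_space,second_countable_topology}, 'f::euclidean_space) atlas"
    and i Jh U J +
  assumes adapted: "adapted_basis A Q B i Jh U J"
begin

lemma J_T: "i p \<in> U \<Longrightarrow> J 1 (i p) (T p v) = T p (Jh p v)"
  using adapted by (simp add: adapted_basis_def)

lemma tangential_J:
  assumes "i p \<in> U"
  shows "P p (J 1 (i p) u) = Jh p (P p u)"
proof (rule tangential_eqI)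
  fix w
  have "\<omega> (i p) (T p (Jh p (P p u))) (T p w) = - \<omega> (i p) (T p (P p u)) (T p (Jh p w))"
    by (simp add: form_J_skew assms flip: J_T)
  also have "\<dots> = \<omega> (i p) (J 1 (i p) u) (T p w)"
    by (simp add: form_tangential form_J_skew J_T assms)
  finally show "\<omega> (i p) (T p (Jh p (P p u))) (T p w) = \<omega> (i p) (J 1 (i p) u) (T p w)" .
qed

lemma cov_tangent_Jh:
  assumes p: "i p \<in> U" and Y: "local_field B p Y"
  shows "cov_tangent p v (\<lambda>q. Jh q (Y q))
    = endo_tensor A DQ (J 1) (i p) (T p v) (T p (Y p)) + J 1 (i p) (cov_tangent p v Y)"
proof -
  let ?Y = "along_rep p (\<lambda>q. T q (Y q))"
  have "(along_rep p (\<lambda>q. T q (Jh q (Y q))) has_derivative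
      (\<lambda>v. endo_deriv A (J 1) (i p) (T p v) (?Y (chart_point p)) + J 1 (i p) (along_deriv p v Y)))
      (at (chart_point p))"
    by (rule has_derivative_endo_along[OF smooth_J open_U p has_derivative_chart_map chart_map_point
          along_rep_has_derivative[OF Y]])
      (rule eventually_mono[OF eventually_in_nhd[OF open_vimage_i[OF open_U], of p]],
        use p in \<open>auto simp: Let_def along_rep_def J_T\<close>)
  from cov_along_eq[OF this]
  show ?thesis
    by (simp add: cov_tangent_eq Y endo_tensor_def linear_add[OF linear_J[OF p]] J_T[OF p])
qed

lemma cov_endo_DN:
  assumes p: "i p \<in> U" and Y: "local_field B p Y"
  shows "cov_endo DN Jh p v Y = P p (conn_forms A DQ J (i p) (T p v) 3 *\<^sub>R J 2 (i p) (T p (Y p))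
    - conn_forms A DQ J (i p) (T p v) 2 *\<^sub>R J 3 (i p) (T p (Y p)))"
  by (simp add: cov_endo_def DN_eq cov_tangent_Jh[OF assms] linear_add[OF linear_tangential]
      tangential_J[OF p] endo_tensor_DQ[OF p])

lemma cov_bilin_DN:
  assumes p: "i p \<in> U" and Y: "local_field B p Y" and Z: "local_field B p Z"
  shows "cov_bilin B DN (induced_metric A \<omega> B i Jh) p v Y Z
    = \<omega> (i p) (T p (Y p)) (T p (cov_endo DN Jh p v Z))"
proof -
  have perp: "\<omega> (i p) (T p (Y p)) u = \<omega> (i p) (T p (Y p)) (T p (P p u))" for u
    using form_tangential[of p u "Y p"] form_antisym by metis
  have "cov_bilin B DN (induced_metric A \<omega> B i Jh) p v Y Z
    = \<omega> (i p) (cov_tangent p v Y) (T p (Jh p (Z p))) + \<omega> (i p) (T p (Y p)) (cov_tangent p v (\<lambda>q. Jh q (Z q)))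
      - \<omega> (i p) (T p (DN p v Y)) (T p (Jh p (Z p))) - \<omega> (i p) (T p (Y p)) (T p (Jh p (DN p v Z)))"
    using dfun_induced_form[OF Y local_field_Jh[OF Z]]
    by (simp add: cov_bilin_def induced_metric_def induced_form_def)
  then show ?thesis
    by (simp add: DN_eq form_tangential perp[of "cov_tangent p v (\<lambda>q. Jh q (Z q))"] cov_endo_def
        linear_diff[OF linear_T] bilinear_rsub[OF bilinear_form])
qed

lemma nijenhuis_vanishes:
  assumes p: "i p \<in> U" and X: "local_field B p X" and Y: "local_field B p Y"
    and par: "\<And>v Y. local_field B p Y \<Longrightarrow> cov_endo DN Jh p v Y = 0"
    and tor: "pi_J (J 1 (i p)) (torsion_at A DQ (i p)) (T p (X p)) (T p (Y p)) = 0"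
  shows "nijenhuis B Jh X Y p = 0"
proof -
  let ?JX = "\<lambda>q. Jh q (X q)" and ?JY = "\<lambda>q. Jh q (Y q)"
  have DJ: "DN p v (\<lambda>q. Jh q (Y q)) = Jh p (DN p v Y)" if "local_field B p Y" for v Y
    using par[OF that] by (simp add: cov_endo_def)
  have tors: "P p (torsion_at A DQ (i p) (T p (X p)) (T p (Y p)))
      = DN p (X p) Y - DN p (Y p) X - lie_bracket B X Y p"
    if "local_field B p X" "local_field B p Y" for X Y
    using that by (simp add: cov_tangent_torsion DN_eq linear_diff[OF linear_tangential])
  note t = tors[OF X Y] tors[OF local_field_Jh[OF X] Y] tors[OF X local_field_Jh[OF Y]]
    tors[OF local_field_Jh[OF X] local_field_Jh[OF Y]]
  let ?t = "\<lambda>v w. torsion_at A DQ (i p) (T p v) (T p w)"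
  have "?t (X p) (Y p) + J 1 (i p) (?t (Jh p (X p)) (Y p) + ?t (X p) (Jh p (Y p)))
      - ?t (Jh p (X p)) (Jh p (Y p)) = 0"
    using tor by (simp add: pi_J_def J_T[OF p])
  then have "P p (?t (X p) (Y p)) + Jh p (P p (?t (Jh p (X p)) (Y p)) + P p (?t (X p) (Jh p (Y p))))
      - P p (?t (Jh p (X p)) (Jh p (Y p))) = 0"
    using linear_0[OF linear_tangential[of p]]
    by (metis (no_types, lifting) linear_add[OF linear_tangential] linear_diff[OF linear_tangential]
        tangential_J[OF p])
  then show ?thesis
    unfolding t nijenhuis_def Let_def
    by (simp add: DJ X Y local_field_Jh linear_add[OF linear_Jh] linear_diff[OF linear_Jh] Jh_square algebra_simps)
qed

end

theorem theorem2p28: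
  fixes A :: "('m::{t2_space,second_countable_topology}, 'e::euclidean_space) atlas"
    and B :: "('p::{t2_space,second_countable_topology}, 'f::euclidean_space) atlas"
    and Q :: "'m \<Rightarrow> ('e \<Rightarrow> 'e) set"
    and \<omega> :: "'m \<Rightarrow> 'e \<Rightarrow> 'e \<Rightarrow> real"
    and i :: "'p \<Rightarrow> 'm"
    and Jh :: "'p \<Rightarrow> 'f \<Rightarrow> 'f"
    and DQvol DQ :: "('m, 'e) conn"
    and DN :: "('p, 'f) conn"
    and H :: "('m set \<times> (3 \<Rightarrow> 'm \<Rightarrow> 'e \<Rightarrow> 'e)) set"
    and n k :: nat
  assumes "n > 1" and "DIM('e) = 4 * n" and "DIM('f) = 2 * k"
    and "almost_qsH A Q \<omega>"
    and "oproiu_connection A Q \<omega> DQvol"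
    and "DQ = adapted_connection A \<omega> DQvol"
    and "almost_pseudo_Hermitian_submanifold A Q \<omega> B i Jh"
    and "\<forall>(U, J)\<in>H. adapted_basis A Q B i Jh U J"
    and "range i \<subseteq> (\<Union>(U, J)\<in>H. U)"
    and "DN = induced_connection A \<omega> DQ B i"
  shows "(complex_parallel B DN Jh \<longleftrightarrow> (\<forall>(U, J)\<in>H. gamma_condition A \<omega> DQ B i U J)) \<and>
     (complex_parallel B DN Jh \<longleftrightarrow> metric_connection B DN (induced_metric A \<omega> B i Jh)) \<and>
     ((\<forall>(U, J)\<in>H. torsion_condition A DQ B i U J) \<and>
        (complex_parallel B DN Jh \<or>
         (\<forall>(U, J)\<in>H. gamma_condition A \<omega> DQ B i U J) \<or>
         metric_connection B DN (induced_metric A \<omega> B i Jh))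
      \<longrightarrow> integrable_acs B Jh)"
proof -
  have manA: "manifold A" and manB: "manifold B"
    using assms(4,7) by (auto simp: manifold_def almost_qsH_def almost_pseudo_Hermitian_submanifold_def
        almost_complex_submanifold_def)
  interpret qsH_submanifold A Q \<omega> DQvol B i Jh
  proof (intro qsH_submanifold.intro qsH_connection.intro qsH_connection_axioms.intro
      qsH_submanifold_axioms.intro)
    show "coordinate_connection A DQvol" "preserves_Q A Q DQvol"
      using assms(5) manifold.coordinate_connectionI[OF manA] by (auto simp: oproiu_connection_def)
  qed (fact manA manB assms(4,7))+
  note [simp] = assms(6,10)
  have adapted: "qsH_adapted A Q \<omega> DQvol B i Jh U J" if "(U, J) \<in> H" for U J
  proof -
    have ad: "adapted_basis A Q B i Jh U J" using assms(8) that by blast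
    have "admissible A Q U J"
      using manA ad by (simp add: admissible_def admissible_axioms_def adapted_basis_def)
    then show ?thesis
      using qsH_submanifold_axioms qsH_connection_axioms ad
      by (simp add: qsH_adapted_def qsH_basis_def qsH_adapted_axioms_def)
  qed
  have cover: "\<exists>U J. (U, J) \<in> H \<and> i p \<in> U" for p
  proof -
    have "i p \<in> (\<Union>(U, J)\<in>H. U)" by (rule subsetD[OF assms(9) rangeI])
    then show ?thesis by auto
  qed
  have gamma: "complex_parallel B DN Jh \<longleftrightarrow> (\<forall>(U, J)\<in>H. gamma_condition A \<omega> DQ B i U J)"
  proof
    assume par: "complex_parallel B DN Jh"
    show "\<forall>(U, J)\<in>H. gamma_condition A \<omega> DQ B i U J"
    proof clarify
      fix U J assume "(U, J) \<in> H"
      then interpret qsH_adapted A Q \<omega> DQvol B i Jh U J by (rule adapted)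
      show "gamma_condition A \<omega> DQ B i U J"
        using par by (simp add: gamma_condition_def complex_parallel_def Let_def flip: cov_endo_DN)
    qed
  next
    assume gam: "\<forall>(U, J)\<in>H. gamma_condition A \<omega> DQ B i U J"
    show "complex_parallel B DN Jh"
      unfolding complex_parallel_def
    proof clarify
      fix p X Y assume XY: "local_field B p X" "local_field B p Y"
      obtain U J where UJ: "(U, J) \<in> H" "i p \<in> U" using cover by blast
      interpret qsH_adapted A Q \<omega> DQvol B i Jh U J by (rule adapted[OF UJ(1)])
      have "gamma_condition A \<omega> DQ B i U J" using gam UJ(1) by blast
      then show "cov_endo DN Jh p (X p) Y = 0"
        using XY UJ(2) by (simp add: gamma_condition_def cov_endo_DN Let_def)
    qed
  qed
  have cov_bilin: "cov_bilin B DN (induced_metric A \<omega> B i Jh) p v Y Z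
      = \<omega> (i p) (tmap B A i p (Y p)) (tmap B A i p (cov_endo DN Jh p v Z))"
    if "local_field B p Y" "local_field B p Z" for p v Y Z
  proof -
    obtain U J where UJ: "(U, J) \<in> H" "i p \<in> U" using cover by blast
    interpret qsH_adapted A Q \<omega> DQvol B i Jh U J by (rule adapted[OF UJ(1)])
    show ?thesis using cov_bilin_DN[OF UJ(2) that] by simp
  qed
  have metric: "complex_parallel B DN Jh \<longleftrightarrow> metric_connection B DN (induced_metric A \<omega> B i Jh)"
  proof
    assume "complex_parallel B DN Jh"
    then show "metric_connection B DN (induced_metric A \<omega> B i Jh)"
      using linear_0[OF linear_T] bilinear_rzero[OF bilinear_form]
      by (simp add: metric_connection_def complex_parallel_def cov_bilin del: assms(6,10))
  next
    assume met: "metric_connection B DN (induced_metric A \<omega> B i Jh)"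
    show "complex_parallel B DN Jh"
      unfolding complex_parallel_def
    proof clarify
      fix p X Z assume X: "local_field B p X" and Z: "local_field B p Z"
      show "cov_endo DN Jh p (X p) Z = 0"
      proof (rule nondegenerate_induced[of p])
        fix w
        obtain Y where Y: "local_field B p Y" "Y p = w" using N.local_field_exists by blast
        have "\<omega> (i p) (tmap B A i p w) (tmap B A i p (cov_endo DN Jh p (X p) Z)) = 0"
          using met X Y Z cov_bilin[OF Y(1) Z] unfolding metric_connection_def by metis
        then show "\<omega> (i p) (tmap B A i p (cov_endo DN Jh p (X p) Z)) (tmap B A i p w) = 0"
          using form_antisym by (metis neg_equal_0_iff_equal)
      qed
    qed
  qed
  have "integrable_acs B Jh"
    if tor: "\<forall>(U, J)\<in>H. torsion_condition A DQ B i U J" and par: "complex_parallel B DN Jh"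
    unfolding integrable_acs_def
  proof clarify
    fix p X Y assume XY: "local_field B p X" "local_field B p Y"
    obtain U J where UJ: "(U, J) \<in> H" "i p \<in> U" using cover by blast
    interpret qsH_adapted A Q \<omega> DQvol B i Jh U J by (rule adapted[OF UJ(1)])
    show "nijenhuis B Jh X Y p = 0"
    proof (rule nijenhuis_vanishes[OF UJ(2) XY])
      fix v Y assume Y: "local_field B p Y"
      obtain V where V: "local_field B p V" "V p = v" using N.local_field_exists by blast
      then show "cov_endo (induced_connection A \<omega> (adapted_connection A \<omega> DQvol) B i) Jh p v Y = 0"
        using par Y by (auto simp: complex_parallel_def)
    next
      have "torsion_condition A DQ B i U J" using tor UJ(1) by blast
      then show "pi_J (J 1 (i p)) (torsion_at A (adapted_connection A \<omega> DQvol) (i p))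
          (tmap B A i p (X p)) (tmap B A i p (Y p)) = 0"
        using UJ(2) XY by (simp add: torsion_condition_def)
    qed
  qed
  with gamma metric show ?thesis by blast
qed

end
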